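(* Let $\Bbbk$ be an algebraically closed field of characteristic zero and let $A$ be a Poisson Hopf $\Bbbk$-algebra. Suppose that (i) as an algebra, $A$ is finitely generated and connected graded, $A=\bigoplus_{i\ge 0}A(i)$ with $A(0)=\Bbbk$; and (ii) the Poisson bracket $\{-,-\}$ is homogeneous of degree $d\geq 0$, i.e. $\{A(i),A(j)\}\subseteq A(i+j+d)$ for all $i,j$. Then $A$ is unimodular; that is, the modular derivation of $A$ is zero.
   Context: A Poisson algebra is a commutative associative $\Bbbk$-algebra $A$ with a bilinear bracket $\{-,-\}$ making $A$ a Lie algebra and satisfying the Leibniz rule $\{ab,c\}=a\{b,c\}+\{a,c\}b$. If $A,B$ are Poisson algebras, $A\otimes B$ is Poisson with $\{a\otimes b,c\otimes d\}=\{a,c\}\otimes bd+ac\otimes\{b,d\}$. A Poisson Hopf algebra is a Poisson algebra $A$ which is also a Hopf algebra such that the comultiplication $\Delta:A\to A\otimes A$ is a Poisson algebra morphism. An algebra satisfying (i) that is a commutative Hopf algebra over $\Bbbk$ is a polynomial algebra $\Bbbk[x_1,\dots,x_n]$. For a Poisson polynomial algebra $A=\Bbbk[x_1,\dots,x_n]$, the modular derivation (with respect to the volume form $dx_1\wedge\cdots\wedge dx_n$) is the Poisson derivation $\delta$ given by $\delta(f)=\sum_{j=1}^n \frac{\partial \{f,x_j\}}{\partial x_j}$ for $f\in A$; $A$ is called unimodular if the class of $\delta$ modulo log-Hamiltonian derivations is trivial, which for a polynomial algebra (whose only units are scalars) means exactly $\delta=0$. *)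

theory Defs
  imports "HOL-Library.Poly_Mapping" "HOL-Computational_Algebra.Polynomial"
begin

text \<open>Polynomial algebra k[x_v | v in 'v] over a field 'k, in the variables of the
  (finite) type 'v: maps from monomials (exponent vectors) to coefficients.\<close>

type_synonym ('v, 'k) pa = "('v \<Rightarrow>\<^sub>0 nat) \<Rightarrow>\<^sub>0 'k"

definition alg_closed :: "'k::field itself \<Rightarrow> bool" where
  "alg_closed _ \<longleftrightarrow> (\<forall>p :: 'k poly. degree p > 0 \<longrightarrow> (\<exists>x. poly p x = 0))"

definition psmult :: "'k::comm_ring_1 \<Rightarrow> ('v, 'k) pa \<Rightarrow> ('v, 'k) pa" where
  "psmult c p = Poly_Mapping.map (\<lambda>a. c * a) p"

definition pconst :: "'k::comm_ring_1 \<Rightarrow> ('v, 'k) pa" where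
  "pconst c = Poly_Mapping.single 0 c"

definition pmon :: "('v \<Rightarrow>\<^sub>0 nat) \<Rightarrow> ('v, 'k::comm_ring_1) pa" where
  "pmon m = Poly_Mapping.single m 1"

definition pvar :: "'v \<Rightarrow> ('v, 'k::comm_ring_1) pa" where
  "pvar j = pmon (Poly_Mapping.single j 1)"

definition pderiv_var :: "'v \<Rightarrow> ('v, 'k::comm_ring_1) pa \<Rightarrow> ('v, 'k) pa" where
  "pderiv_var j p = (\<Sum>m\<in>Poly_Mapping.keys p.
      Poly_Mapping.single (m - Poly_Mapping.single j 1) (of_nat (Poly_Mapping.lookup m j) * Poly_Mapping.lookup p m))"

definition mon_rename :: "('a \<Rightarrow> 'b) \<Rightarrow> ('a \<Rightarrow>\<^sub>0 nat) \<Rightarrow> ('b \<Rightarrow>\<^sub>0 nat)" where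
  "mon_rename h m = (\<Sum>j\<in>Poly_Mapping.keys m. Poly_Mapping.single (h j) (Poly_Mapping.lookup m j))"

definition prename :: "('a \<Rightarrow> 'b) \<Rightarrow> ('a, 'k::comm_ring_1) pa \<Rightarrow> ('b, 'k) pa" where
  "prename h p = (\<Sum>m\<in>Poly_Mapping.keys p. Poly_Mapping.single (mon_rename h m) (Poly_Mapping.lookup p m))"

text \<open>Splitting a monomial in the variables 'a + 'b into its two parts: a monomial
  x^m of k['a + 'b] = k['a] (x) k['b] corresponds to x^(mon_left m) (x) x^(mon_right m).\<close>
definition mon_left :: "('a + 'b \<Rightarrow>\<^sub>0 nat) \<Rightarrow> ('a \<Rightarrow>\<^sub>0 nat)" where
  "mon_left m = (\<Sum>v\<in>Poly_Mapping.keys m.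
     (case v of Inl j \<Rightarrow> Poly_Mapping.single j (Poly_Mapping.lookup m v) | Inr _ \<Rightarrow> 0))"

definition mon_right :: "('a + 'b \<Rightarrow>\<^sub>0 nat) \<Rightarrow> ('b \<Rightarrow>\<^sub>0 nat)" where
  "mon_right m = (\<Sum>v\<in>Poly_Mapping.keys m.
     (case v of Inr j \<Rightarrow> Poly_Mapping.single j (Poly_Mapping.lookup m v) | Inl _ \<Rightarrow> 0))"

text \<open>tensor product f (x) g of k-linear maps f : k['a] -> k['c], g : k['b] -> k['d],
  as a map k['a + 'b] -> k['c + 'd], extended linearly from the monomial basis\<close>
definition tensor_map ::
  "(('a, 'k::comm_ring_1) pa \<Rightarrow> ('c, 'k) pa) \<Rightarrow> (('b, 'k) pa \<Rightarrow> ('d, 'k) pa)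
    \<Rightarrow> ('a + 'b, 'k) pa \<Rightarrow> ('c + 'd, 'k) pa" where
  "tensor_map f g q = (\<Sum>m\<in>Poly_Mapping.keys q. psmult (Poly_Mapping.lookup q m)
     (prename Inl (f (pmon (mon_left m))) * prename Inr (g (pmon (mon_right m)))))"

definition mult_tensor ::
  "(('a, 'k::comm_ring_1) pa \<Rightarrow> ('a, 'k) pa) \<Rightarrow> (('a, 'k) pa \<Rightarrow> ('a, 'k) pa)
    \<Rightarrow> ('a + 'a, 'k) pa \<Rightarrow> ('a, 'k) pa" where
  "mult_tensor f g q = (\<Sum>m\<in>Poly_Mapping.keys q. psmult (Poly_Mapping.lookup q m)
     (f (pmon (mon_left m)) * g (pmon (mon_right m))))"

definition counit_left ::
  "(('a, 'k::comm_ring_1) pa \<Rightarrow> 'k) \<Rightarrow> ('a + 'b, 'k) pa \<Rightarrow> ('b, 'k) pa" where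
  "counit_left e q = (\<Sum>m\<in>Poly_Mapping.keys q.
     psmult (Poly_Mapping.lookup q m * e (pmon (mon_left m))) (pmon (mon_right m)))"

definition counit_right ::
  "(('b, 'k::comm_ring_1) pa \<Rightarrow> 'k) \<Rightarrow> ('a + 'b, 'k) pa \<Rightarrow> ('a, 'k) pa" where
  "counit_right e q = (\<Sum>m\<in>Poly_Mapping.keys q.
     psmult (Poly_Mapping.lookup q m * e (pmon (mon_right m))) (pmon (mon_left m)))"

text \<open>reassociation (A (x) A) (x) A = A (x) (A (x) A) on variables\<close>
definition assoc_var :: "('a + 'b) + 'c \<Rightarrow> 'a + ('b + 'c)" where
  "assoc_var = case_sum (case_sum Inl (Inr \<circ> Inl)) (Inr \<circ> Inr)"

text \<open>the tensor product Poisson bracket on A (x) A = k['a + 'a]: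
  {a(x)b, c(x)d} = {a,c}(x)bd + ac(x){b,d}, extended bilinearly\<close>
definition tensor_bracket ::
  "(('a, 'k::comm_ring_1) pa \<Rightarrow> ('a, 'k) pa \<Rightarrow> ('a, 'k) pa)
    \<Rightarrow> ('a + 'a, 'k) pa \<Rightarrow> ('a + 'a, 'k) pa \<Rightarrow> ('a + 'a, 'k) pa" where
  "tensor_bracket br q r = (\<Sum>m\<in>Poly_Mapping.keys q. \<Sum>m'\<in>Poly_Mapping.keys r.
     psmult (Poly_Mapping.lookup q m * Poly_Mapping.lookup r m')
      (prename Inl (br (pmon (mon_left m)) (pmon (mon_left m')))
         * prename Inr (pmon (mon_right m) * pmon (mon_right m'))
       + prename Inl (pmon (mon_left m) * pmon (mon_left m'))
         * prename Inr (br (pmon (mon_right m)) (pmon (mon_right m')))))"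

definition klinear :: "(('a, 'k::comm_ring_1) pa \<Rightarrow> ('b, 'k) pa) \<Rightarrow> bool" where
  "klinear f \<longleftrightarrow> (\<forall>p q. f (p + q) = f p + f q) \<and> (\<forall>c p. f (psmult c p) = psmult c (f p))"

definition poisson_bracket :: "(('a, 'k::comm_ring_1) pa \<Rightarrow> ('a, 'k) pa \<Rightarrow> ('a, 'k) pa) \<Rightarrow> bool" where
  "poisson_bracket br \<longleftrightarrow>
     (\<forall>p. klinear (br p)) \<and> (\<forall>p. klinear (\<lambda>q. br q p)) \<and>
     (\<forall>p. br p p = 0) \<and>
     (\<forall>p q r. br p (br q r) + br q (br r p) + br r (br p q) = 0) \<and>
     (\<forall>p q r. br (p * q) r = p * br q r + br p r * q)"

definition poisson_hopf ::
  "(('a, 'k::comm_ring_1) pa \<Rightarrow> ('a, 'k) pa \<Rightarrow> ('a, 'k) pa)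
   \<Rightarrow> (('a, 'k) pa \<Rightarrow> ('a + 'a, 'k) pa) \<Rightarrow> (('a, 'k) pa \<Rightarrow> 'k)
   \<Rightarrow> (('a, 'k) pa \<Rightarrow> ('a, 'k) pa) \<Rightarrow> bool" where
  "poisson_hopf br D e S \<longleftrightarrow>
     poisson_bracket br \<and>
     \<comment> \<open>D is a unital algebra homomorphism\<close>
     klinear D \<and> (\<forall>p q. D (p * q) = D p * D q) \<and> D 1 = 1 \<and>
     \<comment> \<open>e is a unital algebra homomorphism to k\<close>
     (\<forall>p q. e (p + q) = e p + e q) \<and> (\<forall>c p. e (psmult c p) = c * e p) \<and>
     (\<forall>p q. e (p * q) = e p * e q) \<and> e 1 = 1 \<and>
     \<comment> \<open>coassociativity\<close>
     (\<forall>p. prename assoc_var (tensor_map D id (D p)) = tensor_map id D (D p)) \<and>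
     \<comment> \<open>counit axioms\<close>
     (\<forall>p. counit_left e (D p) = p) \<and> (\<forall>p. counit_right e (D p) = p) \<and>
     \<comment> \<open>antipode\<close>
     klinear S \<and>
     (\<forall>p. mult_tensor S id (D p) = pconst (e p)) \<and>
     (\<forall>p. mult_tensor id S (D p) = pconst (e p)) \<and>
     \<comment> \<open>D is a Poisson morphism\<close>
     (\<forall>p q. D (br p q) = tensor_bracket br (D p) (D q))"

definition ksubspace :: "('a, 'k::comm_ring_1) pa set \<Rightarrow> bool" where
  "ksubspace V \<longleftrightarrow> 0 \<in> V \<and> (\<forall>p\<in>V. \<forall>q\<in>V. p + q \<in> V) \<and> (\<forall>c. \<forall>p\<in>V. psmult c p \<in> V)"

definition connected_graded :: "(nat \<Rightarrow> ('a, 'k::comm_ring_1) pa set) \<Rightarrow> bool" where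
  "connected_graded G \<longleftrightarrow>
     (\<forall>i. ksubspace (G i)) \<and>
     (\<forall>p. \<exists>!c :: nat \<Rightarrow> ('a, 'k) pa. (\<forall>i. c i \<in> G i) \<and> finite {i. c i \<noteq> 0}
            \<and> p = (\<Sum>i\<in>{i. c i \<noteq> 0}. c i)) \<and>
     (\<forall>i j. \<forall>p\<in>G i. \<forall>q\<in>G j. p * q \<in> G (i + j)) \<and>
     G 0 = range pconst"

text \<open>modular derivation with respect to dx_1 /\ ... /\ dx_n\<close>
definition modular_derivation ::
  "(('a::finite, 'k::comm_ring_1) pa \<Rightarrow> ('a, 'k) pa \<Rightarrow> ('a, 'k) pa) \<Rightarrow> ('a, 'k) pa \<Rightarrow> ('a, 'k) pa" where
  "modular_derivation br f = (\<Sum>j\<in>UNIV. pderiv_var j (br f (pvar j)))"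

end

theory Submission
  imports Defs "HOL-Analysis.Determinants"
begin

text \<open>
  Let \<open>\<delta>\<close> be the modular derivation, \<open>e\<close> the counit and \<open>L\<^sub>j\<close>, \<open>R\<^sub>j\<close> the left and right
  invariant derivations extending the tangent vectors \<open>e \<circ> \<partial>\<^sub>j\<close>. The antipode inverts the matrix
  \<open>L\<^sub>j x\<^sub>i\<close>, so its determinant is a unit, hence a scalar; by Jacobi's formula no correction term
  appears when \<open>\<delta>\<close> is computed in the frame \<open>L\<close>, and compatibility of the coproduct with the bracket
  gives \<open>\<delta> f = f\<^sub>1 e(\<delta> f\<^sub>2) + U f\<close>, where \<open>U\<close> is the contraction of the bracket with \<open>L\<close>. The frame
  \<open>R\<close> yields \<open>\<delta> f = e(\<delta> f\<^sub>1) f\<^sub>2 + U' f\<close>, and \<open>U + U' = 0\<close> because \<open>L\<close> and \<open>R\<close> commute while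
  the bracket is antisymmetric. It remains to see that \<open>e \<circ> \<delta> = 0\<close>. The augmentation \<open>\<epsilon>\<close> of the
  grading kills all brackets, hence \<open>U\<close>; it also kills \<open>\<delta>\<close>, since for \<open>b\<close> of degree \<open>i\<close> and the
  Euler derivation \<open>E\<close> the divergence of \<open>[E, {b, -}] = (i + d) {b, -}\<close> is
  \<open>E (\<delta> b) - {b, div E}\<close>. So the first formula evaluated at \<open>\<epsilon>\<close> forces \<open>e \<circ> \<delta> = 0\<close>, and adding
  the two formulas gives \<open>2 \<delta> = 0\<close>.
\<close>

section \<open>Polynomials and derivations\<close>

lemma psmult_eq: "psmult c p = pconst c * p"
  by (simp add: psmult_def pconst_def mult_map_scale_conv_mult)

lemma pconst_0 [simp]: "pconst 0 = 0"
  and pconst_1 [simp]: "pconst 1 = 1"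
  and pconst_add: "pconst (a + b) = pconst a + pconst b"
  and pconst_mult: "pconst (a * b) = pconst a * pconst b"
  by (simp_all add: pconst_def single_add mult_single)

lemma pconst_sum: "pconst (\<Sum>i\<in>I. f i) = (\<Sum>i\<in>I. pconst (f i))"
  by (induction I rule: infinite_finite_induct) (simp_all add: pconst_add)

lemma inj_pconst: "pconst a = pconst b \<longleftrightarrow> a = b"
  using injD[OF inj_single] by (auto simp: pconst_def)

lemma pconst_minus: "pconst (- a) = - pconst a"
  by (simp add: pconst_def single_uminus)

lemma pmon_0 [simp]: "pmon 0 = 1"
  by (simp add: pmon_def)

lemma pmon_add: "pmon (m + n) = pmon m * pmon n"
  by (simp add: pmon_def mult_single)

lemma single_eq_pconst_pmon: "Poly_Mapping.single m c = pconst c * pmon m"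
  by (simp add: pconst_def pmon_def mult_single)

lemma monomial_expansion:
  "p = (\<Sum>m\<in>Poly_Mapping.keys p. pconst (Poly_Mapping.lookup p m) * pmon m)"
proof (rule poly_mapping_eqI)
  fix k
  show "Poly_Mapping.lookup p k =
    Poly_Mapping.lookup (\<Sum>m\<in>Poly_Mapping.keys p. pconst (Poly_Mapping.lookup p m) * pmon m) k"
    by (simp add: lookup_sum single_eq_pconst_pmon[symmetric] lookup_single when_def in_keys_iff)
qed

section \<open>Linear maps and the monomial basis\<close>

lemma klinear_iff:
  "klinear f \<longleftrightarrow> (\<forall>p q. f (p + q) = f p + f q) \<and> (\<forall>c p. f (pconst c * p) = pconst c * f p)"
  by (simp add: klinear_def psmult_eq)

lemma klinearI:
  assumes "\<And>p q. f (p + q) = f p + f q" and "\<And>c p. f (pconst c * p) = pconst c * f p"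
  shows "klinear f"
  using assms by (simp add: klinear_iff)

lemma klinear_add: "klinear f \<Longrightarrow> f (p + q) = f p + f q"
  and klinear_scale: "klinear f \<Longrightarrow> f (pconst c * p) = pconst c * f p"
  by (simp_all add: klinear_iff)

lemma klinear_0: "klinear f \<Longrightarrow> f 0 = 0"
  using klinear_scale[of f 0 0] by simp

lemma klinear_sum: "klinear f \<Longrightarrow> f (\<Sum>i\<in>I. g i) = (\<Sum>i\<in>I. f (g i))"
  by (induction I rule: infinite_finite_induct) (simp_all add: klinear_0 klinear_add)

lemma klinear_minus: "klinear f \<Longrightarrow> f (- p) = - f p"
  using klinear_scale[of f "-1" p] by (simp add: pconst_minus)

lemma klinear_diff: "klinear f \<Longrightarrow> f (p - q) = f p - f q"
  using klinear_add[of f p "- q"] by (simp add: klinear_minus)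

lemma klinear_id [simp]: "klinear (\<lambda>p. p)" "klinear id"
  by (auto intro: klinearI)

lemma klinear_compose: "klinear f \<Longrightarrow> klinear g \<Longrightarrow> klinear (\<lambda>p. f (g p))"
  by (simp add: klinear_iff)

lemma klinear_plus: "klinear f \<Longrightarrow> klinear g \<Longrightarrow> klinear (\<lambda>p. f p + g p)"
  by (simp add: klinear_iff algebra_simps)

lemma klinear_mult_left: "klinear f \<Longrightarrow> klinear (\<lambda>p. a * f p)"
  by (simp add: klinear_iff algebra_simps)

lemma klinear_mult_right: "klinear f \<Longrightarrow> klinear (\<lambda>p. f p * a)"
  by (simp add: klinear_iff algebra_simps)

lemma klinear_sum_fun: "(\<And>i. i \<in> I \<Longrightarrow> klinear (f i)) \<Longrightarrow> klinear (\<lambda>p. \<Sum>i\<in>I. f i p)"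
  by (auto intro!: klinearI simp: klinear_add klinear_scale sum.distrib sum_distrib_left)

lemmas klinear_intros = klinear_plus klinear_mult_left klinear_mult_right klinear_sum_fun klinear_id

lemma klinear_monomial_expansion:
  assumes "klinear f"
  shows "f p = (\<Sum>m\<in>Poly_Mapping.keys p. pconst (Poly_Mapping.lookup p m) * f (pmon m))"
  by (subst (1) monomial_expansion) (simp add: klinear_sum[OF assms] klinear_scale[OF assms])

lemma klinear_eqI:
  assumes "klinear f" and "klinear g" and "\<And>m. f (pmon m) = g (pmon m)"
  shows "f p = g p"
  using klinear_monomial_expansion[OF assms(1), of p] klinear_monomial_expansion[OF assms(2), of p] assms(3)
  by simp

text \<open>A key lost by cancellation or scaling has coefficient 0 and contributes nothing, so the
  varying index set does no harm. Linearity of \<open>pderiv_var\<close>, \<open>prename\<close> and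
  \<open>sweedler\<close> follows from this.\<close>

lemma klinear_sum_keys:
  "klinear (\<lambda>p. \<Sum>m\<in>Poly_Mapping.keys p. pconst (Poly_Mapping.lookup p m) * F m)"
proof (rule klinearI)
  fix p q :: "('a, 'b) pa" and c :: 'b
  show "(\<Sum>m\<in>Poly_Mapping.keys (p + q). pconst (Poly_Mapping.lookup (p + q) m) * F m) =
    (\<Sum>m\<in>Poly_Mapping.keys p. pconst (Poly_Mapping.lookup p m) * F m) +
    (\<Sum>m\<in>Poly_Mapping.keys q. pconst (Poly_Mapping.lookup q m) * F m)"
    by (rule setsum_keys_plus_distrib) (simp_all add: pconst_add algebra_simps)
  have look: "Poly_Mapping.lookup (pconst c * p) m = c * Poly_Mapping.lookup p m" for m
    unfolding psmult_eq[symmetric] psmult_def by (simp add: Poly_Mapping.map.rep_eq when_def)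
  have "(\<Sum>m\<in>Poly_Mapping.keys (pconst c * p). pconst (Poly_Mapping.lookup (pconst c * p) m) * F m) =
    (\<Sum>m\<in>Poly_Mapping.keys p. pconst (Poly_Mapping.lookup (pconst c * p) m) * F m)"
    by (rule sum.mono_neutral_left) (auto simp: in_keys_iff look)
  then show "(\<Sum>m\<in>Poly_Mapping.keys (pconst c * p). pconst (Poly_Mapping.lookup (pconst c * p) m) * F m) =
    pconst c * (\<Sum>m\<in>Poly_Mapping.keys p. pconst (Poly_Mapping.lookup p m) * F m)"
    by (simp add: look pconst_mult sum_distrib_left mult.assoc)
qed

lemma keys_pmon: "Poly_Mapping.keys (pmon m :: ('a, 'k::comm_ring_1) pa) = {m}"
  by (simp add: pmon_def)

lemma lookup_pmon_self: "Poly_Mapping.lookup (pmon m) m = 1"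
  by (simp add: pmon_def)

lemma sum_keys_pmon:
  "(\<Sum>n\<in>Poly_Mapping.keys (pmon m). pconst (Poly_Mapping.lookup (pmon m) n) * F n) = F m"
  by (simp add: keys_pmon lookup_pmon_self)

text \<open>Exponent vectors form the free commutative monoid on the variables, so identities
  between additive functions of a monomial can be checked on powers of one variable.\<close>

lemma additive_single_eqI:
  fixes f g :: "('a \<Rightarrow>\<^sub>0 nat) \<Rightarrow> 'b::comm_monoid_add"
  assumes "f 0 = 0" "g 0 = 0" "\<And>m n. f (m + n) = f m + f n" "\<And>m n. g (m + n) = g m + g n"
    and "\<And>j c. f (Poly_Mapping.single j c) = g (Poly_Mapping.single j c)"
  shows "f m = g m"
proof -
  have m: "m = (\<Sum>j\<in>Poly_Mapping.keys m. Poly_Mapping.single j (Poly_Mapping.lookup m j))"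
    by (rule poly_mapping_eqI) (simp add: lookup_sum lookup_single when_def in_keys_iff)
  have hom: "h (\<Sum>j\<in>J. s j) = (\<Sum>j\<in>J. h (s j))"
    if "h 0 = 0" "\<And>m n. h (m + n) = h m + h n"
    for h :: "('a \<Rightarrow>\<^sub>0 nat) \<Rightarrow> 'b" and J :: "'a set" and s
    using that by (induction J rule: infinite_finite_induct) simp_all
  show ?thesis
    by (subst (1 2) m) (simp add: hom assms)
qed

lemma monomial_induct [case_names zero add]:
  fixes P :: "('a \<Rightarrow>\<^sub>0 nat) \<Rightarrow> bool"
  assumes "P 0" and "\<And>j m. P m \<Longrightarrow> P (Poly_Mapping.single j 1 + m)"
  shows "P m"
proof (induction m rule: update_induct)
  case const
  show ?case by (rule assms(1))
next
  case (update m j c)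
  have "Poly_Mapping.update j c m = Poly_Mapping.single j c + m"
    using update(1) by (intro poly_mapping_eqI) (auto simp: lookup_update lookup_add lookup_single when_def in_keys_iff)
  moreover have "P (Poly_Mapping.single j c + m)" for c
  proof (induction c)
    case 0
    show ?case using update by simp
  next
    case (Suc c)
    have "Poly_Mapping.single j (Suc c) + m = Poly_Mapping.single j 1 + (Poly_Mapping.single j c + m)"
      by (metis add.assoc plus_1_eq_Suc single_add)
    then show ?case
      using assms(2)[OF Suc, of j] by simp
  qed
  ultimately show ?case by simp
qed

section \<open>Derivations and partial derivatives\<close>

definition derivation :: "(('a, 'k::comm_ring_1) pa \<Rightarrow> ('a, 'k) pa) \<Rightarrow> bool" where
  "derivation Y \<longleftrightarrow> klinear Y \<and> (\<forall>p q. Y (p * q) = p * Y q + Y p * q)"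

lemma derivation_klinear: "derivation Y \<Longrightarrow> klinear Y"
  and derivation_mult: "derivation Y \<Longrightarrow> Y (p * q) = p * Y q + Y p * q"
  by (simp_all add: derivation_def)

lemma derivation_1: "derivation Y \<Longrightarrow> Y 1 = 0"
  using derivation_mult[of Y 1 1] by simp

lemma derivation_pconst: "derivation Y \<Longrightarrow> Y (pconst c) = 0"
  using klinear_scale[of Y c 1] by (simp add: derivation_klinear derivation_1)

lemma derivation_eqI:
  assumes "derivation Y" "derivation Z" "\<And>j. Y (pvar j) = Z (pvar j)"
  shows "Y p = Z p"
proof (rule klinear_eqI[of Y Z])
  show "Y (pmon m) = Z (pmon m)" for m
    by (induction m rule: monomial_induct)
      (simp_all add: pmon_add assms(3)[unfolded pvar_def, simplified] derivation_1[OF assms(1)] derivation_1[OF assms(2)]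
        derivation_mult[OF assms(1)] derivation_mult[OF assms(2)])
qed (use assms in \<open>auto simp: derivation_klinear\<close>)

lemma pderiv_var_eq:
  "pderiv_var j p = (\<Sum>m\<in>Poly_Mapping.keys p. pconst (Poly_Mapping.lookup p m) *
     (of_nat (Poly_Mapping.lookup m j) * pmon (m - Poly_Mapping.single j 1)))"
  unfolding pderiv_var_def
  by (rule sum.cong) (simp_all add: pconst_def pmon_def mult_single flip: single_of_nat, simp_all add: mult_ac)

lemma klinear_pderiv_var: "klinear (pderiv_var j)"
  unfolding pderiv_var_eq by (rule klinear_sum_keys)

lemma pderiv_var_pmon:
  "pderiv_var j (pmon m) = of_nat (Poly_Mapping.lookup m j) * pmon (m - Poly_Mapping.single j 1)"
  by (simp add: pderiv_var_eq sum_keys_pmon)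

lemma derivation_pderiv_var: "derivation (pderiv_var j)"
proof -
  \<comment> \<open>Exponents are subtracted with truncation. If \<open>j\<close> does not occur in
    \<open>m\<close>, the coefficient 0 hides the wrong exponent; otherwise the subtraction commutes
    with adding \<open>n\<close>.\<close>
  have shift: "of_nat (Poly_Mapping.lookup m j) * (pmon (m - Poly_Mapping.single j 1) * pmon n) =
      of_nat (Poly_Mapping.lookup m j) * (pmon (m + n - Poly_Mapping.single j 1) :: ('a, 'b) pa)" for m n
  proof (cases "Poly_Mapping.lookup m j = 0")
    case False
    then have "m - Poly_Mapping.single j 1 + n = m + n - Poly_Mapping.single j 1"
      by (intro poly_mapping_eqI) (auto simp: lookup_add lookup_minus lookup_single when_def)
    then show ?thesis by (simp add: pmon_add[symmetric])
  qed simp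
  have mon: "pderiv_var j (pmon m * pmon n) =
      pmon m * pderiv_var j (pmon n) + pderiv_var j (pmon m) * (pmon n :: ('a, 'b) pa)" for m n
    using shift[of m n] shift[of n m]
    by (simp add: pmon_add[of m n, symmetric] pderiv_var_pmon lookup_add algebra_simps)
  have half: "pderiv_var j (pmon m * q) = pmon m * pderiv_var j q + pderiv_var j (pmon m) * q"
    for m and q :: "('a, 'b) pa"
    by (rule klinear_eqI[where p = q])
      (intro klinear_intros klinear_pderiv_var mon
        klinear_compose[OF klinear_pderiv_var klinear_mult_left[OF klinear_id(1)]])+
  have "pderiv_var j (p * q) = p * pderiv_var j q + pderiv_var j p * q" for p q :: "('a, 'b) pa"
    by (rule klinear_eqI[where p = p])
      (intro klinear_intros klinear_pderiv_var half
        klinear_compose[OF klinear_pderiv_var klinear_mult_right[OF klinear_id(1)]])+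
  then show ?thesis by (simp add: derivation_def klinear_pderiv_var)
qed

lemma pderiv_var_pvar: "pderiv_var j (pvar i) = (if i = j then 1 else 0)"
  by (simp add: pvar_def pderiv_var_pmon lookup_single when_def)

lemma derivation_linear_combination:
  assumes "\<And>i. i \<in> I \<Longrightarrow> derivation (Y i)"
  shows "derivation (\<lambda>p. \<Sum>i\<in>I. a i * Y i p)"
proof -
  have "klinear (\<lambda>p. \<Sum>i\<in>I. a i * Y i p)"
    by (intro klinear_sum_fun klinear_mult_left derivation_klinear assms)
  moreover have "(\<Sum>i\<in>I. a i * Y i (p * q)) = p * (\<Sum>i\<in>I. a i * Y i q) + (\<Sum>i\<in>I. a i * Y i p) * q" for p q
    by (simp add: derivation_mult[OF assms] algebra_simps sum.distrib sum_distrib_left)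
  ultimately show ?thesis by (simp add: derivation_def)
qed

lemma derivation_expansion:
  fixes Y :: "('v::finite, 'k::comm_ring_1) pa \<Rightarrow> ('v, 'k) pa"
  assumes "derivation Y"
  shows "Y p = (\<Sum>j\<in>UNIV. Y (pvar j) * pderiv_var j p)"
  by (rule derivation_eqI[OF assms derivation_linear_combination[OF derivation_pderiv_var]])
    (simp add: pderiv_var_pvar if_distrib cong: if_cong)

lemma derivation_commutator:
  assumes "derivation Y" "derivation Z"
  shows "derivation (\<lambda>p. Y (Z p) - Z (Y p))"
proof -
  have "klinear (\<lambda>p. Y (Z p) - Z (Y p))"
    using assms by (intro klinearI) (simp_all add: derivation_klinear klinear_add klinear_scale right_diff_distrib)
  then show ?thesis
    using assms by (simp add: derivation_def klinear_add algebra_simps)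
qed

lemma derivation_zero: "derivation (\<lambda>_. 0)"
  by (simp add: derivation_def klinear_iff)

lemma pderiv_var_commute: "pderiv_var i (pderiv_var j p) = pderiv_var j (pderiv_var i p)"
proof -
  have "pderiv_var i (pderiv_var j p) - pderiv_var j (pderiv_var i p) = (\<lambda>_. 0) p"
    by (rule derivation_eqI[OF derivation_commutator[OF derivation_pderiv_var derivation_pderiv_var]
          derivation_zero])
      (simp add: pderiv_var_pvar derivation_1[OF derivation_pderiv_var]
        klinear_0[OF klinear_pderiv_var])
  then show ?thesis by simp
qed

section \<open>Determinants over commutative rings\<close>

text \<open>This is Cramer's rule: by linearity in row \<open>k\<close>, each \<open>l\<close> other
  than \<open>k\<close> contributes a determinant with two equal rows.\<close>

lemma det_row_combination:
  fixes A :: "'a::comm_ring_1^'n^'n"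
  shows "det (\<chi> i. if i = k then (\<Sum>l\<in>UNIV. x l *s row l A) else row i A) = x k * det A"
proof -
  have single: "det (\<chi> i. if i = k then row l A else row i A) = (if l = k then det A else 0)" for l
  proof (cases "l = k")
    case True
    then have "(\<chi> i. if i = k then row l A else row i A) = A"
      by (simp add: vec_eq_iff row_def)
    with True show ?thesis by simp
  next
    case False
    then show ?thesis
      by (auto intro!: det_identical_rows[of k l] simp: row_def vec_eq_iff)
  qed
  have "det (\<chi> i. if i = k then (\<Sum>l\<in>UNIV. x l *s row l A) else row i A) =
      (\<Sum>l\<in>UNIV. det (\<chi> i. if i = k then x l *s row l A else row i A))"
    by (rule det_linear_row_sum) simp
  also have "\<dots> = (\<Sum>l\<in>UNIV. x l * (if l = k then det A else 0))"
    by (simp add: det_row_mul single)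
  finally show ?thesis by (simp add: if_distrib cong: if_cong)
qed

text \<open>With \<open>c = a ** b - mat 1\<close> one has \<open>c ** a = 0\<close>, a linear
  relation between the rows of \<open>a\<close>. Cramer's rule then gives
  \<open>c $ r $ k * det a = 0\<close>, and \<open>det a\<close> is a unit.\<close>

lemma left_inverse_imp_right_inverse:
  fixes A B :: "'n::finite \<Rightarrow> 'n \<Rightarrow> 'a::comm_ring_1"
  assumes "\<And>i j. (\<Sum>k\<in>UNIV. B i k * A k j) = (if i = j then 1 else 0)"
  shows "(\<Sum>k\<in>UNIV. A i k * B k j) = (if i = j then 1 else 0)"
proof -
  define a b where "a = (\<chi> i j. A i j)" and "b = (\<chi> i j. B i j)"
  have ba: "b ** a = mat 1"
    by (simp add: a_def b_def vec_eq_iff matrix_matrix_mult_def mat_def assms)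
  then have unit: "det b * det a = 1"
    by (metis det_I det_mul)
  define c where "c = a ** b - mat 1"
  have "(c + mat 1) ** a = a"
    by (simp add: c_def matrix_mul_assoc[symmetric] ba)
  moreover have "(c + mat 1) ** a = c ** a + mat 1 ** a"
    by (simp add: vec_eq_iff matrix_matrix_mult_def distrib_right sum.distrib)
  ultimately have "c ** a = 0" by simp
  have "c $ r $ k = 0" for r k
  proof -
    have "(\<Sum>l\<in>UNIV. (c $ r $ l) *s row l a) = 0"
      using \<open>c ** a = 0\<close>
      by (simp add: vec_eq_iff matrix_matrix_mult_def row_def)
    then have "c $ r $ k * det a = det (\<chi> i. if i = k then 0 else row i a)"
      unfolding det_row_combination[of k "\<lambda>l. c $ r $ l" a, symmetric] by (simp only:)
    then have "c $ r $ k * det a = 0"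
      by (simp add: det_row_0)
    then have "c $ r $ k * (det b * det a) = 0"
      by (metis mult.left_commute mult_zero_right)
    then show ?thesis by (simp add: unit)
  qed
  then have "a ** b = mat 1"
    by (simp add: c_def vec_eq_iff)
  then show ?thesis
    by (simp add: a_def b_def vec_eq_iff matrix_matrix_mult_def mat_def)
qed

lemma derivation_prod:
  assumes "derivation Y" and "finite I"
  shows "Y (\<Prod>i\<in>I. f i) = (\<Sum>k\<in>I. \<Prod>i\<in>I. if i = k then Y (f i) else f i)"
  using assms(2)
proof (induction I)
  case empty
  show ?case by (simp add: derivation_1[OF assms(1)])
next
  case (insert a I)
  have "(\<Prod>i\<in>I. if i = a then Y (f i) else f i) = (\<Prod>i\<in>I. f i)"
    using insert.hyps by (intro prod.cong) auto
  moreover have "(\<Sum>k\<in>I. (if a = k then Y (f a) else f a) * (\<Prod>i\<in>I. if i = k then Y (f i) else f i)) =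
      (\<Sum>k\<in>I. f a * (\<Prod>i\<in>I. if i = k then Y (f i) else f i))"
    using insert.hyps by (intro sum.cong) auto
  ultimately show ?case
    using insert by (simp add: derivation_mult[OF assms(1)] sum_distrib_left)
qed

lemma derivation_det:
  fixes A :: "('a, 'k::comm_ring_1) pa^'n^'n"
  assumes "derivation Y"
  shows "Y (det A) = (\<Sum>k\<in>UNIV. det (\<chi> i. if i = k then (\<chi> j. Y (A $ i $ j)) else row i A))"
proof -
  have sgn: "Y (of_int (sign p) * q) = of_int (sign p) * Y q" for p :: "'n \<Rightarrow> 'n" and q
    by (simp add: sign_def klinear_minus[OF derivation_klinear[OF assms]])
  have "Y (det A) = (\<Sum>p | p permutes UNIV. of_int (sign p) *
      (\<Sum>k\<in>UNIV. \<Prod>i\<in>UNIV. if i = k then Y (A $ i $ p i) else A $ i $ p i))"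
    by (simp add: det_def klinear_sum[OF derivation_klinear[OF assms]] sgn derivation_prod[OF assms])
  also have "\<dots> = (\<Sum>k\<in>UNIV. \<Sum>p | p permutes UNIV. of_int (sign p) *
      (\<Prod>i\<in>UNIV. if i = k then Y (A $ i $ p i) else A $ i $ p i))"
    by (subst sum.swap) (simp add: sum_distrib_left)
  also have "\<dots> = (\<Sum>k\<in>UNIV. det (\<chi> i. if i = k then (\<chi> j. Y (A $ i $ j)) else row i A))"
    unfolding det_def by (intro sum.cong refl arg_cong2[where f = "(*)"] prod.cong) (simp add: row_def)
  finally show ?thesis .
qed

text \<open>Jacobi's formula. Since \<open>B\<close> inverts \<open>A\<close>, row \<open>k\<close>
  of the differentiated matrix is the combination of the rows of \<open>A\<close> with coefficients
  \<open>M k l\<close>, so differentiating row \<open>k\<close> multiplies the determinant by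
  \<open>M k k\<close>.\<close>

lemma derivation_det_eq_trace:
  fixes A B :: "'n::finite \<Rightarrow> 'n \<Rightarrow> ('a, 'k::comm_ring_1) pa"
  assumes "derivation Y"
    and inv: "\<And>i j. (\<Sum>k\<in>UNIV. B i k * A k j) = (if i = j then 1 else 0)"
  shows "Y (det (\<chi> i j. A i j)) = (\<Sum>i\<in>UNIV. \<Sum>s\<in>UNIV. Y (A i s) * B s i) * det (\<chi> i j. A i j)"
proof -
  define a where "a = (\<chi> i j. A i j)"
  define M where "M i l = (\<Sum>s\<in>UNIV. Y (A i s) * B s l)" for i l
  have "(\<Sum>l\<in>UNIV. M i l *s row l a) $ j = Y (A i j)" for i j
  proof -
    have "(\<Sum>l\<in>UNIV. M i l *s row l a) $ j = (\<Sum>l\<in>UNIV. \<Sum>s\<in>UNIV. Y (A i s) * (B s l * A l j))"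
      by (simp add: M_def row_def a_def sum_distrib_right mult.assoc)
    also have "\<dots> = (\<Sum>s\<in>UNIV. Y (A i s) * (\<Sum>l\<in>UNIV. B s l * A l j))"
      by (subst sum.swap) (simp add: sum_distrib_left)
    finally show ?thesis by (simp add: inv if_distrib cong: if_cong)
  qed
  then have row: "(\<chi> j. Y (a $ i $ j)) = (\<Sum>l\<in>UNIV. M i l *s row l a)" for i
    by (simp add: vec_eq_iff a_def)
  have "Y (det a) = (\<Sum>k\<in>UNIV. det (\<chi> i. if i = k then (\<Sum>l\<in>UNIV. M k l *s row l a) else row i a))"
    unfolding derivation_det[OF assms(1)] row
    by (intro sum.cong refl arg_cong[where f = det]) (auto simp: vec_eq_iff)
  also have "\<dots> = (\<Sum>k\<in>UNIV. M k k * det a)"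
    by (simp add: det_row_combination)
  finally show ?thesis by (simp add: a_def M_def sum_distrib_right)
qed

section \<open>Units of polynomial algebras\<close>

lemma mon_rename_add: "mon_rename h (m + n) = mon_rename h m + mon_rename h n"
  unfolding mon_rename_def by (rule setsum_keys_plus_distrib) (simp_all add: single_add)

lemma mon_rename_0 [simp]: "mon_rename h 0 = 0"
  by (simp add: mon_rename_def)

lemma mon_rename_single [simp]: "mon_rename h (Poly_Mapping.single j c) = Poly_Mapping.single (h j) c"
  by (cases "c = 0") (simp_all add: mon_rename_def)

lemma lookup_mon_rename:
  assumes "inj h"
  shows "Poly_Mapping.lookup (mon_rename h m) (h j) = Poly_Mapping.lookup m j"
  by (rule additive_single_eqI)
    (use assms in \<open>simp_all add: mon_rename_add lookup_add lookup_single when_def inj_eq\<close>)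

lemma nat_poly_mapping_ge_0: "0 \<le> (m :: nat \<Rightarrow>\<^sub>0 nat)"
proof (cases "m = 0")
  case False
  then obtain k where k: "Poly_Mapping.lookup m k \<noteq> 0"
    by (metis lookup_zero poly_mapping_eqI)
  define l where "l = (LEAST k. Poly_Mapping.lookup m k \<noteq> 0)"
  have "Poly_Mapping.lookup m l \<noteq> 0" "\<And>k'. k' < l \<Longrightarrow> Poly_Mapping.lookup m k' = 0"
    using LeastI[of "\<lambda>k. Poly_Mapping.lookup m k \<noteq> 0", OF k] not_less_Least unfolding l_def by blast+
  then have "0 < m"
    by (auto simp: less_poly_mapping.rep_eq less_fun_def intro!: exI[of _ l])
  then show ?thesis by simp
qed simp

text \<open>The lexicographic order on exponent vectors, obtained by numbering the variables, makes the
  leading monomials of two polynomials multiply.\<close>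
lemma unit_imp_pconst:
  fixes p q :: "('v::finite, 'k::field) pa"
  assumes "p * q = 1"
  shows "p \<in> range pconst"
proof -
  obtain h :: "'v \<Rightarrow> nat" where h: "inj h"
    using finite_imp_inj_to_nat_seg[of "UNIV :: 'v set"] by auto
  let ?r = "mon_rename h"
  have inj: "m = n" if "?r m = ?r n" for m n
    using that by (metis h lookup_mon_rename poly_mapping_eqI)
  have top: "\<exists>m\<in>Poly_Mapping.keys f. \<forall>n\<in>Poly_Mapping.keys f. n \<noteq> m \<longrightarrow> ?r n < ?r m"
    if "f \<noteq> 0" for f :: "('v, 'k) pa"
  proof -
    have "Max (?r ` Poly_Mapping.keys f) \<in> ?r ` Poly_Mapping.keys f"
      using that by (intro Max_in) auto
    then obtain m where "m \<in> Poly_Mapping.keys f" "?r m = Max (?r ` Poly_Mapping.keys f)" by force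
    then show ?thesis
      by (metis Max_ge finite_imageI finite_keys image_eqI inj order_le_less)
  qed
  have "p \<noteq> 0" "q \<noteq> 0" using assms by auto
  from top[OF this(1)] top[OF this(2)] obtain m n where m: "m \<in> Poly_Mapping.keys p" "\<And>k. k \<in> Poly_Mapping.keys p \<Longrightarrow> k \<noteq> m \<Longrightarrow> ?r k < ?r m"
    and n: "n \<in> Poly_Mapping.keys q" "\<And>k. k \<in> Poly_Mapping.keys q \<Longrightarrow> k \<noteq> n \<Longrightarrow> ?r k < ?r n"
    by blast
  \<comment> \<open>Only the two leading monomials multiply to \<open>m + n\<close>, so the
    coefficient there is a product of two nonzero field elements and cannot cancel.\<close>
  have unique: "(k, l) = (m, n)" if kl: "k \<in> Poly_Mapping.keys p" "l \<in> Poly_Mapping.keys q" "m + n = k + l" for k l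
  proof (rule ccontr)
    assume neq: "(k, l) \<noteq> (m, n)"
    have "?r k + ?r l < ?r m + ?r n"
    proof (cases "k = m")
      case True
      with neq n kl have "?r l < ?r n" by auto
      with True show ?thesis by simp
    next
      case False
      then have "?r k < ?r m" using m kl by auto
      moreover have "?r l \<le> ?r n" using n kl by (cases "l = n") (auto simp: less_imp_le)
      ultimately show ?thesis by (rule add_less_le_mono)
    qed
    with kl show False by (metis mon_rename_add less_irrefl)
  qed
  have pq: "p * q = (\<Sum>k\<in>Poly_Mapping.keys p. \<Sum>l\<in>Poly_Mapping.keys q.
      Poly_Mapping.single (k + l) (Poly_Mapping.lookup p k * Poly_Mapping.lookup q l))"
    by (subst (1) monomial_expansion[of p], subst (1) monomial_expansion[of q])
      (simp add: sum_product single_eq_pconst_pmon[symmetric] mult_single)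
  have "Poly_Mapping.lookup (p * q) (m + n) = (\<Sum>k\<in>Poly_Mapping.keys p. \<Sum>l\<in>Poly_Mapping.keys q.
      if (k, l) = (m, n) then Poly_Mapping.lookup p m * Poly_Mapping.lookup q n else 0)"
    unfolding pq lookup_sum
    by (intro sum.cong refl) (auto simp: lookup_single when_def dest: unique)
  also have "\<dots> = (\<Sum>k\<in>Poly_Mapping.keys p. if k = m then Poly_Mapping.lookup p m * Poly_Mapping.lookup q n else 0)"
    using n(1) by (intro sum.cong refl) (auto simp: if_distrib cong: if_cong)
  also have "\<dots> = Poly_Mapping.lookup p m * Poly_Mapping.lookup q n"
    using m(1) by simp
  finally have "Poly_Mapping.lookup (1 :: ('v, 'k) pa) (m + n) \<noteq> 0"
    using m(1) n(1) by (simp add: assms in_keys_iff)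
  then have "m + n = 0" by (simp add: lookup_one when_def split: if_splits)
  then have "m = 0"
    by (intro poly_mapping_eqI) (metis add_is_0 lookup_add lookup_zero)
  \<comment> \<open>The leading exponent of \<open>p\<close> is 0, the least possible one, so no
    other monomial can lie below it.\<close>
  have "k = 0" if "k \<in> Poly_Mapping.keys p" for k
    using m(2)[OF that] nat_poly_mapping_ge_0[of "?r k"] \<open>m = 0\<close> by (auto simp: leD)
  then have "p = pconst (Poly_Mapping.lookup p 0)"
    by (intro poly_mapping_eqI) (auto simp: pconst_def lookup_single when_def in_keys_iff)
  then show ?thesis by (rule range_eqI)
qed

section \<open>Poisson brackets and modular derivations\<close>

context
  fixes br :: "('v, 'k::comm_ring_1) pa \<Rightarrow> ('v, 'k) pa \<Rightarrow> ('v, 'k) pa"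
  assumes br: "poisson_bracket br"
begin

lemma bracket_klinear_right: "klinear (br p)"
  and bracket_klinear_left: "klinear (\<lambda>q. br q p)"
  and bracket_self: "br p p = 0"
  using br by (simp_all add: poisson_bracket_def)

lemma bracket_antisym: "br p q = - br q p"
proof -
  have "br (p + q) (p + q) = br p q + br q p"
    unfolding klinear_add[OF bracket_klinear_right] klinear_add[OF bracket_klinear_left]
    by (simp add: bracket_self)
  then have "br p q + br q p = 0"
    unfolding bracket_self[of "p + q"] by (rule sym)
  then show ?thesis
    by (rule eq_neg_iff_add_eq_0[THEN iffD2])
qed

lemma derivation_bracket_left: "derivation (\<lambda>q. br q p)"
  using br by (simp add: derivation_def poisson_bracket_def)

lemma derivation_bracket_right: "derivation (br p)"
  unfolding derivation_def
proof (intro conjI allI)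
  fix q r
  show "br p (q * r) = q * br p r + br p q * r"
    unfolding bracket_antisym[of p] derivation_mult[OF derivation_bracket_left, of q r p] by simp
qed (rule bracket_klinear_right)

end

section \<open>The modular derivation in a frame of derivations\<close>

text \<open>Expanding \<open>E j f\<close> in partial derivatives produces the matrix
  \<open>E j (pvar l)\<close>. Undoing it needs \<open>N\<close> on its other side, hence the right
  inverse.\<close>

lemma pderiv_var_frame:
  fixes N :: "'v::finite \<Rightarrow> 'v \<Rightarrow> ('v, 'k::comm_ring_1) pa"
  assumes der: "\<And>j. derivation (E j)"
    and inv: "\<And>i j. (\<Sum>k\<in>UNIV. N i k * E j (pvar k)) = (if i = j then 1 else 0)"
  shows "pderiv_var i f = (\<Sum>j\<in>UNIV. N j i * E j f)"
proof -
  have "(\<Sum>j\<in>UNIV. N j i * E j f) = (\<Sum>j\<in>UNIV. \<Sum>l\<in>UNIV. pderiv_var l f * (E j (pvar l) * N j i))"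
    by (simp add: derivation_expansion[OF der, of _ f] sum_distrib_left mult_ac)
  also have "\<dots> = (\<Sum>l\<in>UNIV. pderiv_var l f * (\<Sum>j\<in>UNIV. E j (pvar l) * N j i))"
    by (subst sum.swap) (simp add: sum_distrib_left)
  also have "\<dots> = pderiv_var i f"
    by (simp add: left_inverse_imp_right_inverse[of N "\<lambda>l j. E j (pvar l)", OF inv] if_distrib cong: if_cong)
  finally show ?thesis by simp
qed

text \<open>Once the partial derivatives are written in the frame, the terms with
  \<open>br b (E j (pvar i))\<close> form the logarithmic derivative of the frame determinant and
  drop out. The functions \<open>Q\<close> measure how far \<open>E j\<close> is from being a
  derivation of the bracket; only their trace survives.\<close>

lemma modular_derivation_frame:
  fixes br :: "('v::finite, 'k::field) pa \<Rightarrow> ('v, 'k) pa \<Rightarrow> ('v, 'k) pa"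
    and N :: "'v \<Rightarrow> 'v \<Rightarrow> ('v, 'k) pa"
  assumes br: "poisson_bracket br"
    and der: "\<And>j. derivation (E j)"
    and inv: "\<And>i j. (\<Sum>k\<in>UNIV. N i k * E j (pvar k)) = (if i = j then 1 else 0)"
    and E_br: "\<And>j b c. E j (br b c) = br (E j b) c + br b (E j c) + (\<Sum>p\<in>UNIV. Q j p b * E p c)"
  shows "modular_derivation br b =
    (\<Sum>j\<in>UNIV. Q j j b) + (\<Sum>i\<in>UNIV. \<Sum>j\<in>UNIV. N j i * br (E j b) (pvar i))"
proof -
  let ?A = "\<lambda>i j. E j (pvar i)"
  have "det (\<chi> i j. N i j) * det (\<chi> i j. ?A i j) = 1"
    by (subst det_mul[symmetric]) (simp add: matrix_matrix_mult_def inv flip: mat_def)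
  then have unit: "det (\<chi> i j. ?A i j) * det (\<chi> i j. N i j) = 1"
    by (subst mult.commute)
  then have cancel: "f = 0" if "f * det (\<chi> i j. ?A i j) = 0" for f
  proof -
    have "f = f * det (\<chi> i j. ?A i j) * det (\<chi> i j. N i j)"
      by (simp only: mult.assoc unit mult_1_right)
    then show ?thesis by (simp only: that mult_zero_left)
  qed
  \<comment> \<open>Units of the polynomial algebra are scalars, and scalars have zero bracket with
    everything; by Jacobi's formula this removes the correction term.\<close>
  from unit have "det (\<chi> i j. ?A i j) \<in> range pconst"
    by (rule unit_imp_pconst)
  then have "br b (det (\<chi> i j. ?A i j)) = 0"
    using derivation_pconst[OF derivation_bracket_right[OF br]] by auto
  then have "(\<Sum>i\<in>UNIV. \<Sum>j\<in>UNIV. br b (?A i j) * N j i) * det (\<chi> i j. ?A i j) = 0"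
    by (simp add: derivation_det_eq_trace[OF derivation_bracket_right[OF br], of N ?A, OF inv])
  then have trace: "(\<Sum>i\<in>UNIV. \<Sum>j\<in>UNIV. br b (?A i j) * N j i) = 0"
    by (rule cancel)
  have Q: "(\<Sum>i\<in>UNIV. \<Sum>j\<in>UNIV. N j i * (\<Sum>p\<in>UNIV. Q j p b * ?A i p)) = (\<Sum>j\<in>UNIV. Q j j b)"
  proof -
    have "(\<Sum>i\<in>UNIV. \<Sum>j\<in>UNIV. N j i * (\<Sum>p\<in>UNIV. Q j p b * ?A i p)) =
        (\<Sum>i\<in>UNIV. \<Sum>j\<in>UNIV. \<Sum>p\<in>UNIV. Q j p b * (N j i * ?A i p))"
      by (simp add: sum_distrib_left mult_ac)
    also have "\<dots> = (\<Sum>j\<in>UNIV. \<Sum>i\<in>UNIV. \<Sum>p\<in>UNIV. Q j p b * (N j i * ?A i p))"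
      by (rule sum.swap)
    also have "\<dots> = (\<Sum>j\<in>UNIV. \<Sum>p\<in>UNIV. \<Sum>i\<in>UNIV. Q j p b * (N j i * ?A i p))"
      by (intro sum.cong refl sum.swap)
    also have "\<dots> = (\<Sum>j\<in>UNIV. \<Sum>p\<in>UNIV. Q j p b * (if j = p then 1 else 0))"
      by (simp add: sum_distrib_left[symmetric] inv)
    finally show ?thesis by (simp add: if_distrib cong: if_cong)
  qed
  have "modular_derivation br b = (\<Sum>i\<in>UNIV. \<Sum>j\<in>UNIV. N j i * E j (br b (pvar i)))"
    by (simp add: modular_derivation_def pderiv_var_frame[of E N, OF der inv])
  also have "\<dots> = (\<Sum>i\<in>UNIV. \<Sum>j\<in>UNIV. N j i * br (E j b) (pvar i)) +
      (\<Sum>i\<in>UNIV. \<Sum>j\<in>UNIV. br b (?A i j) * N j i) +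
      (\<Sum>i\<in>UNIV. \<Sum>j\<in>UNIV. N j i * (\<Sum>p\<in>UNIV. Q j p b * ?A i p))"
    by (simp add: E_br distrib_left sum.distrib mult.commute)
  finally show ?thesis
    by (simp add: trace Q)
qed

context
  fixes br :: "('v::finite, 'k::comm_ring_1) pa \<Rightarrow> ('v, 'k) pa \<Rightarrow> ('v, 'k) pa"
  assumes br: "poisson_bracket br"
begin

text \<open>The cross terms of the two Leibniz rules add up to \<open>br g f + br f g\<close>, which
  is 0.\<close>

lemma derivation_modular_derivation: "derivation (modular_derivation br)"
proof -
  have "klinear (modular_derivation br)"
    unfolding modular_derivation_def
    by (intro klinear_sum_fun klinear_compose[OF klinear_pderiv_var] bracket_klinear_left[OF br])
  moreover have "modular_derivation br (f * g) = f * modular_derivation br g + modular_derivation br f * g" for f g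
  proof -
    have "br g f = (\<Sum>j\<in>UNIV. br g (pvar j) * pderiv_var j f)" "br f g = (\<Sum>j\<in>UNIV. br f (pvar j) * pderiv_var j g)"
      by (rule derivation_expansion[OF derivation_bracket_right[OF br]])+
    then have "(\<Sum>j\<in>UNIV. br g (pvar j) * pderiv_var j f) + (\<Sum>j\<in>UNIV. br f (pvar j) * pderiv_var j g) = 0"
      using bracket_antisym[OF br, of f g] by (metis add.right_inverse)
    then show ?thesis
      by (simp add: modular_derivation_def derivation_mult[OF derivation_bracket_left[OF br]]
          derivation_mult[OF derivation_pderiv_var] klinear_add[OF klinear_pderiv_var]
          sum.distrib sum_distrib_left algebra_simps)
  qed
  ultimately show ?thesis by (simp add: derivation_def)
qed

text \<open>Expanding each bracket further in the opposite frame pairs second derivatives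
  \<open>E' q (E j f)\<close> with \<open>br (pvar p) (pvar i)\<close>. Commutation makes the
  coefficients symmetric under exchanging the two frames together with \<open>i\<close> and
  \<open>p\<close>, while the bracket changes sign.\<close>

lemma commuting_frames_cancel:
  fixes N N' :: "'v \<Rightarrow> 'v \<Rightarrow> ('v, 'k) pa"
  assumes E: "\<And>j. derivation (E j)" "\<And>i j. (\<Sum>k\<in>UNIV. N i k * E j (pvar k)) = (if i = j then 1 else 0)"
    and E': "\<And>j. derivation (E' j)" "\<And>i j. (\<Sum>k\<in>UNIV. N' i k * E' j (pvar k)) = (if i = j then 1 else 0)"
    and commute: "\<And>i j f. E i (E' j f) = E' j (E i f)"
  shows "(\<Sum>i\<in>UNIV. \<Sum>j\<in>UNIV. N j i * br (E j f) (pvar i)) +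
    (\<Sum>i\<in>UNIV. \<Sum>j\<in>UNIV. N' j i * br (E' j f) (pvar i)) = 0"
proof -
  have expand: "(\<Sum>i\<in>UNIV. \<Sum>j\<in>UNIV. M j i * br (Y j f) (pvar i)) =
      (\<Sum>i\<in>UNIV. \<Sum>j\<in>UNIV. \<Sum>p\<in>UNIV. \<Sum>q\<in>UNIV. M j i * M' q p * Y' q (Y j f) * br (pvar p) (pvar i))"
    if "\<And>j. derivation (Y' j)" "\<And>i j. (\<Sum>k\<in>UNIV. M' i k * Y' j (pvar k)) = (if i = j then 1 else 0)"
    for M M' :: "'v \<Rightarrow> 'v \<Rightarrow> ('v, 'k) pa" and Y Y'
  proof (intro sum.cong refl)
    fix i j
    have "br (Y j f) (pvar i) = (\<Sum>p\<in>UNIV. br (pvar p) (pvar i) * (\<Sum>q\<in>UNIV. M' q p * Y' q (Y j f)))"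
      unfolding pderiv_var_frame[of Y' M', OF that, symmetric]
      by (rule derivation_expansion[OF derivation_bracket_left[OF br]])
    then show "M j i * br (Y j f) (pvar i) =
        (\<Sum>p\<in>UNIV. \<Sum>q\<in>UNIV. M j i * M' q p * Y' q (Y j f) * br (pvar p) (pvar i))"
      by (simp add: sum_distrib_left mult_ac)
  qed
  let ?t = "\<lambda>i j p q. N j i * N' q p * E' q (E j f) * br (pvar p) (pvar i)"
  \<comment> \<open>The bound indices are renamed so that \<open>p\<close>, \<open>q\<close> belong
    to the primed frame; the later swaps only restore the order \<open>i\<close>, \<open>j\<close>,
    \<open>p\<close>, \<open>q\<close>.\<close>
  have "(\<Sum>i\<in>UNIV. \<Sum>j\<in>UNIV. N' j i * br (E' j f) (pvar i)) =
      (\<Sum>p\<in>UNIV. \<Sum>q\<in>UNIV. \<Sum>i\<in>UNIV. \<Sum>j\<in>UNIV. - ?t i j p q)"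
    unfolding expand[OF E, of N' E']
    by (intro sum.cong refl) (subst bracket_antisym[OF br], simp add: commute mult_ac)
  also have "\<dots> = (\<Sum>p\<in>UNIV. \<Sum>i\<in>UNIV. \<Sum>q\<in>UNIV. \<Sum>j\<in>UNIV. - ?t i j p q)"
    by (intro sum.cong refl sum.swap)
  also have "\<dots> = (\<Sum>i\<in>UNIV. \<Sum>p\<in>UNIV. \<Sum>q\<in>UNIV. \<Sum>j\<in>UNIV. - ?t i j p q)"
    by (rule sum.swap)
  also have "\<dots> = (\<Sum>i\<in>UNIV. \<Sum>p\<in>UNIV. \<Sum>j\<in>UNIV. \<Sum>q\<in>UNIV. - ?t i j p q)"
    by (intro sum.cong refl sum.swap)
  also have "\<dots> = (\<Sum>i\<in>UNIV. \<Sum>j\<in>UNIV. \<Sum>p\<in>UNIV. \<Sum>q\<in>UNIV. - ?t i j p q)"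
    by (intro sum.cong refl sum.swap)
  also have "\<dots> = - (\<Sum>i\<in>UNIV. \<Sum>j\<in>UNIV. N j i * br (E j f) (pvar i))"
    unfolding expand[OF E', of N E] by (simp add: sum_negf)
  finally show ?thesis by simp
qed

end

section \<open>Gradings\<close>

text \<open>Differentiating \<open>Y (Z (pvar j))\<close> and summing yields \<open>Y\<close> of the
  divergence of \<open>Z\<close> plus the trace of the product of the two Jacobian matrices. That
  trace is symmetric in \<open>Y\<close> and \<open>Z\<close> and cancels.\<close>

lemma divergence_commutator:
  fixes Y Z :: "('v::finite, 'k::comm_ring_1) pa \<Rightarrow> ('v, 'k) pa"
  assumes "derivation Y" "derivation Z"
  shows "(\<Sum>j\<in>UNIV. pderiv_var j (Y (Z (pvar j)) - Z (Y (pvar j)))) =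
    Y (\<Sum>j\<in>UNIV. pderiv_var j (Z (pvar j))) - Z (\<Sum>j\<in>UNIV. pderiv_var j (Y (pvar j)))"
proof -
  have half: "(\<Sum>j\<in>UNIV. pderiv_var j (Y (Z (pvar j)))) =
      (\<Sum>j\<in>UNIV. \<Sum>k\<in>UNIV. pderiv_var j (Y (pvar k)) * pderiv_var k (Z (pvar j))) +
      Y (\<Sum>j\<in>UNIV. pderiv_var j (Z (pvar j)))"
    if "derivation Y" for Y Z :: "('v, 'k) pa \<Rightarrow> ('v, 'k) pa"
  proof -
    have "pderiv_var j (Y f) = (\<Sum>k\<in>UNIV. pderiv_var j (Y (pvar k)) * pderiv_var k f) + Y (pderiv_var j f)" for j f
      unfolding derivation_expansion[OF that, of f] derivation_expansion[OF that, of "pderiv_var j f"]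
      by (simp add: klinear_sum[OF klinear_pderiv_var] derivation_mult[OF derivation_pderiv_var]
          pderiv_var_commute[of j] sum.distrib add.commute)
    from this[of _ "Z (pvar _)"] show ?thesis
      unfolding klinear_sum[OF derivation_klinear[OF that]] sum.distrib[symmetric] by (rule sum.cong[OF refl])
  qed
  have "(\<Sum>j\<in>UNIV. \<Sum>k\<in>UNIV. pderiv_var j (Y (pvar k)) * pderiv_var k (Z (pvar j))) =
      (\<Sum>j\<in>UNIV. \<Sum>k\<in>UNIV. pderiv_var j (Z (pvar k)) * pderiv_var k (Y (pvar j)))"
    by (subst sum.swap) (simp add: mult.commute)
  then show ?thesis
    by (simp add: klinear_diff[OF klinear_pderiv_var] sum_subtractf half[OF assms(1)] half[OF assms(2)])
qed

lemma graded_pconst: "connected_graded G \<Longrightarrow> p \<in> G 0 \<longleftrightarrow> p \<in> range pconst"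
  by (simp add: connected_graded_def)

lemma graded_mult: "connected_graded G \<Longrightarrow> p \<in> G i \<Longrightarrow> q \<in> G j \<Longrightarrow> p * q \<in> G (i + j)"
  by (simp add: connected_graded_def)

lemma graded_induct [consumes 1, case_names homogeneous add]:
  assumes G: "connected_graded G"
    and hom: "\<And>i p. p \<in> G i \<Longrightarrow> P p"
    and add: "\<And>p q. P p \<Longrightarrow> P q \<Longrightarrow> P (p + q)"
  shows "P p"
proof -
  have P0: "P 0"
    using G hom[of 0 0] unfolding connected_graded_def ksubspace_def by blast
  obtain c where c: "\<forall>i. c i \<in> G i" "p = (\<Sum>i\<in>{i. c i \<noteq> 0}. c i)"
    using G unfolding connected_graded_def by blast
  have "P (\<Sum>i\<in>I. c i)" for I
    by (induction I rule: infinite_finite_induct) (use P0 c(1) in \<open>auto intro: add[OF hom]\<close>)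
  then show ?thesis using c(2) by simp
qed

text \<open>Uniqueness makes homogeneous components linear in \<open>p\<close>, so each degree can
  be rescaled separately. The indicator of degree 0 gives the augmentation, and the weight
  \<open>of_nat\<close> the Euler derivation.\<close>

lemma graded_weight_map:
  fixes G :: "nat \<Rightarrow> ('a, 'k::comm_ring_1) pa set" and w :: "nat \<Rightarrow> 'k"
  assumes "connected_graded G"
  obtains T where "klinear T" and "\<And>i p. p \<in> G i \<Longrightarrow> T p = pconst (w i) * p"
proof -
  define dec where "dec p c \<longleftrightarrow> (\<forall>i. c i \<in> G i) \<and> finite {i. c i \<noteq> 0} \<and> p = (\<Sum>i\<in>{i. c i \<noteq> 0}. c i)"
    for p and c :: "nat \<Rightarrow> ('a, 'k) pa"
  have unique: "\<exists>!c. dec p c" for p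
    using assms by (simp add: connected_graded_def dec_def)
  have G: "0 \<in> G i" "p \<in> G i \<Longrightarrow> q \<in> G i \<Longrightarrow> p + q \<in> G i" "p \<in> G i \<Longrightarrow> pconst c * p \<in> G i" for i p q c
    using assms by (simp_all add: connected_graded_def ksubspace_def psmult_eq)
  define comp where "comp p = (THE c. dec p c)" for p
  have dec: "dec p (comp p)" for p
    unfolding comp_def by (rule theI'[OF unique])
  have comp_eq: "comp p = c" if "dec p c" for p c
    using that dec unique by blast
  have decI: "dec p c" if "finite I" "\<And>i. c i \<in> G i" "\<And>i. i \<notin> I \<Longrightarrow> c i = 0" "p = (\<Sum>i\<in>I. c i)" for I p c
  proof -
    have sub: "{i. c i \<noteq> 0} \<subseteq> I" using that(3) by auto
    then have "(\<Sum>i\<in>I. c i) = (\<Sum>i\<in>{i. c i \<noteq> 0}. c i)"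
      by (intro sum.mono_neutral_right) (use that in auto)
    then show ?thesis
      using that finite_subset[OF sub] by (simp add: dec_def)
  qed
  define supp where "supp p = {i. comp p i \<noteq> 0}" for p
  have supp: "finite (supp p)" "\<And>i. comp p i \<in> G i" "\<And>I. finite I \<Longrightarrow> supp p \<subseteq> I \<Longrightarrow> p = (\<Sum>i\<in>I. comp p i)" for p
  proof -
    show "finite (supp p)" "\<And>i. comp p i \<in> G i"
      using dec[of p] by (auto simp: dec_def supp_def)
    show "p = (\<Sum>i\<in>I. comp p i)" if "finite I" "supp p \<subseteq> I" for I
    proof -
      have "p = (\<Sum>i\<in>supp p. comp p i)"
        using dec[of p] by (simp add: dec_def supp_def)
      also have "\<dots> = (\<Sum>i\<in>I. comp p i)"
        by (rule sum.mono_neutral_left) (use that in \<open>auto simp: supp_def\<close>)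
      finally show ?thesis .
    qed
  qed
  have comp_add: "comp (p + q) = (\<lambda>i. comp p i + comp q i)" for p q
  proof (intro comp_eq decI[of "supp p \<union> supp q"])
    show "p + q = (\<Sum>i\<in>supp p \<union> supp q. comp p i + comp q i)"
      using supp(3)[of "supp p \<union> supp q" p] supp(3)[of "supp p \<union> supp q" q] supp(1)
      by (simp add: sum.distrib)
  qed (use supp G in \<open>auto simp: supp_def\<close>)
  have comp_scale: "comp (pconst a * p) = (\<lambda>i. pconst a * comp p i)" for a p
  proof (intro comp_eq decI[of "supp p"])
    show "pconst a * p = (\<Sum>i\<in>supp p. pconst a * comp p i)"
      using supp(3)[of "supp p" p] supp(1) by (simp flip: sum_distrib_left)
  qed (use supp G in \<open>auto simp: supp_def\<close>)
  have comp_hom: "comp p = (\<lambda>k. if k = i then p else 0)" if "p \<in> G i" for p i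
    by (intro comp_eq decI[of "{i}"]) (use that G in auto)
  define T where "T p = (\<Sum>i\<in>supp p. pconst (w i) * comp p i)" for p
  have T: "T p = (\<Sum>i\<in>I. pconst (w i) * comp p i)" if "finite I" "supp p \<subseteq> I" for I p
    unfolding T_def by (rule sum.mono_neutral_left) (use that in \<open>auto simp: supp_def\<close>)
  show thesis
  proof (rule that)
    show "klinear T"
    proof (rule klinearI)
      fix p q a
      have "supp (p + q) \<subseteq> supp p \<union> supp q" "supp (pconst a * p) \<subseteq> supp p"
        by (auto simp: supp_def comp_add comp_scale)
      then show "T (p + q) = T p + T q"
        using T[of "supp p \<union> supp q" p] T[of "supp p \<union> supp q" q] T[of "supp p \<union> supp q" "p + q"] supp(1)
        by (simp add: comp_add distrib_left sum.distrib)
      show "T (pconst a * p) = pconst a * T p"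
        using T[of "supp p" "pconst a * p"] supp(1) \<open>supp (pconst a * p) \<subseteq> supp p\<close>
        by (simp add: T_def comp_scale sum_distrib_left mult.left_commute)
    qed
    show "T p = pconst (w i) * p" if "p \<in> G i" for i p
    proof -
      have "supp p \<subseteq> {i}"
        by (auto simp: supp_def comp_hom[OF that] split: if_splits)
      then show ?thesis
        using T[of "{i}" p] by (simp add: comp_hom[OF that])
    qed
  qed
qed

lemma graded_augmentation:
  fixes br :: "('v::finite, 'k::field_char_0) pa \<Rightarrow> ('v, 'k) pa \<Rightarrow> ('v, 'k) pa"
  assumes br: "poisson_bracket br" and G: "connected_graded G"
    and hom: "\<And>i j p q. p \<in> G i \<Longrightarrow> q \<in> G j \<Longrightarrow> br p q \<in> G (i + j + d)"
  obtains \<epsilon> :: "('v, 'k) pa \<Rightarrow> ('v, 'k) pa" where "klinear \<epsilon>" "\<And>p q. \<epsilon> (p * q) = \<epsilon> p * \<epsilon> q" "\<epsilon> 1 = 1"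
    "\<And>p q. \<epsilon> (br p q) = 0" "\<And>p. \<epsilon> (modular_derivation br p) = 0"
proof -
  \<comment> \<open>\<open>\<epsilon>\<close> is the projection onto \<open>G 0\<close>, that is,
    the augmentation with its values regarded as constant polynomials.\<close>
  obtain \<epsilon> where \<epsilon>: "klinear \<epsilon>" "\<And>i p. p \<in> G i \<Longrightarrow> \<epsilon> p = pconst (if i = 0 then 1 else 0) * p"
    using graded_weight_map[OF G, of "\<lambda>i. if i = 0 then 1 else 0"] by metis
  obtain E where E: "klinear E" "\<And>i p. p \<in> G i \<Longrightarrow> E p = pconst (of_nat i) * p"
    using graded_weight_map[OF G, of of_nat] by metis
  have \<epsilon>_mult: "\<epsilon> (p * q) = \<epsilon> p * \<epsilon> q" for p q
  proof (induction p rule: graded_induct[OF G])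
    case (1 i p)
    then show ?case
      by (induction q rule: graded_induct[OF G])
        (auto simp: \<epsilon>(2) graded_mult[OF G, THEN \<epsilon>(2)] klinear_add[OF \<epsilon>(1)] distrib_left)
  qed (simp add: klinear_add[OF \<epsilon>(1)] distrib_right)
  have E_mult: "E (p * q) = p * E q + E p * q" for p q
  proof (induction p rule: graded_induct[OF G])
    case (1 i p)
    then show ?case
      by (induction q rule: graded_induct[OF G])
        (auto simp: E(2) graded_mult[OF G, THEN E(2)] klinear_add[OF E(1)] pconst_add algebra_simps)
  qed (simp add: klinear_add[OF E(1)] algebra_simps)
  then have der_E: "derivation E"
    by (simp add: derivation_def E(1))
  have \<epsilon>_1: "\<epsilon> 1 = 1"
    using \<epsilon>(2)[of 1 0] by (simp add: graded_pconst[OF G] range_eqI[of 1 pconst 1])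
  have \<epsilon>_E: "\<epsilon> (E p) = 0" for p
    by (induction p rule: graded_induct[OF G])
      (simp_all add: E(2) klinear_scale[OF \<epsilon>(1)] \<epsilon>(2) klinear_add[OF E(1)] klinear_add[OF \<epsilon>(1)])
  have br_0: "br p q = 0" if "p \<in> G 0" for p q
    using that derivation_pconst[OF derivation_bracket_left[OF br]] by (auto simp: graded_pconst[OF G])
  have \<epsilon>_br: "\<epsilon> (br p q) = 0" for p q
  proof (induction p rule: graded_induct[OF G])
    case (1 i p)
    then show ?case
    proof (induction q rule: graded_induct[OF G])
      case (1 j q)
      show ?case
      \<comment> \<open>In degree 0 the first argument is a scalar and the bracket vanishes;
        otherwise the bracket has degree \<open>i + j + d > 0\<close>.\<close>
      proof (cases "i = 0")
        case True
        with 1 show ?thesis by (simp add: br_0 klinear_0[OF \<epsilon>(1)])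
      next
        case False
        with 1 hom show ?thesis by (simp add: \<epsilon>(2)[of _ "i + j + d"])
      qed
    qed (simp add: klinear_add[OF bracket_klinear_right[OF br]] klinear_add[OF \<epsilon>(1)])
  qed (simp add: klinear_add[OF bracket_klinear_left[OF br]] klinear_add[OF \<epsilon>(1)])
  have \<epsilon>_modular: "\<epsilon> (modular_derivation br b) = 0" for b
  proof (induction b rule: graded_induct[OF G])
    case (1 i b)
    show ?case
    proof (cases "i = 0")
      case True
      with 1 show ?thesis
        by (simp add: modular_derivation_def br_0 klinear_0[OF \<epsilon>(1)] klinear_0[OF klinear_pderiv_var])
    next
      case False
      let ?n = "of_nat (i + d) :: 'k"
      have comm: "E (br b c) - br b (E c) = pconst ?n * br b c" for c
      proof (induction c rule: graded_induct[OF G])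
        case (1 k c)
        with \<open>b \<in> G i\<close> show ?case
          by (simp add: E(2)[OF hom] E(2) klinear_scale[OF bracket_klinear_right[OF br]] pconst_add distrib_right)
      qed (simp add: klinear_add[OF bracket_klinear_right[OF br]] klinear_add[OF E(1)] algebra_simps)
      \<comment> \<open>The divergence of \<open>br b\<close> is
        \<open>modular_derivation br b\<close>. On the right, \<open>\<epsilon>\<close> kills the
        image of \<open>E\<close> and all brackets, and \<open>?n\<close> is invertible because
        \<open>i > 0\<close> and the characteristic is zero.\<close>
      have "pconst ?n * modular_derivation br b =
          E (modular_derivation br b) - br b (\<Sum>j\<in>UNIV. pderiv_var j (E (pvar j)))"
        using divergence_commutator[OF der_E derivation_bracket_right[OF br, of b]]
        by (simp only: comm klinear_scale[OF klinear_pderiv_var] modular_derivation_def sum_distrib_left)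
      then have "pconst ?n * \<epsilon> (modular_derivation br b) = 0"
        using klinear_scale[OF \<epsilon>(1), of ?n "modular_derivation br b"]
        by (simp add: klinear_diff[OF \<epsilon>(1)] \<epsilon>_E \<epsilon>_br)
      then have "pconst (inverse ?n) * (pconst ?n * \<epsilon> (modular_derivation br b)) = 0"
        by simp
      moreover have "inverse ?n * ?n = 1"
        using False by (intro left_inverse) (simp del: of_nat_add)
      ultimately show ?thesis
        by (simp only: mult.assoc[symmetric] pconst_mult[symmetric] pconst_1 mult_1_left)
    qed
  next
    case (2 p q)
    then show ?case
      by (simp add: klinear_add[OF derivation_klinear[OF derivation_modular_derivation[OF br]]]
          klinear_add[OF \<epsilon>(1)])
  qed
  show thesis
    by (rule that[OF \<epsilon>(1) \<epsilon>_mult \<epsilon>_1 \<epsilon>_br \<epsilon>_modular])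
qed

section \<open>Tensor products and coproducts\<close>

lemma mon_left_add: "mon_left (m + n) = mon_left m + mon_left n"
  unfolding mon_left_def
  by (rule setsum_keys_plus_distrib[where f = "\<lambda>v c. case v of Inl j \<Rightarrow> Poly_Mapping.single j c | Inr _ \<Rightarrow> 0"])
    (simp_all add: single_add split: sum.split)

lemma mon_right_add: "mon_right (m + n) = mon_right m + mon_right n"
  unfolding mon_right_def
  by (rule setsum_keys_plus_distrib[where f = "\<lambda>v c. case v of Inr j \<Rightarrow> Poly_Mapping.single j c | Inl _ \<Rightarrow> 0"])
    (simp_all add: single_add split: sum.split)

lemma mon_left_0 [simp]: "mon_left 0 = 0" and mon_right_0 [simp]: "mon_right 0 = 0"
  by (simp_all add: mon_left_def mon_right_def)

lemma mon_left_single [simp]: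
  "mon_left (Poly_Mapping.single (Inl j) c) = Poly_Mapping.single j c"
  "mon_left (Poly_Mapping.single (Inr i) c) = 0"
  and mon_right_single [simp]:
  "mon_right (Poly_Mapping.single (Inr i) c) = Poly_Mapping.single i c"
  "mon_right (Poly_Mapping.single (Inl j) c) = 0"
  by (cases "c = 0"; simp add: mon_left_def mon_right_def)+

lemma mon_left_rename [simp]: "mon_left (mon_rename Inl a) = a" "mon_left (mon_rename Inr b) = 0"
  and mon_right_rename [simp]: "mon_right (mon_rename Inr b) = b" "mon_right (mon_rename Inl a) = 0"
  by (rule additive_single_eqI; simp add: mon_rename_add mon_left_add mon_right_add)+

lemma mon_left_right: "mon_rename Inl (mon_left m) + mon_rename Inr (mon_right m) = m"
proof (rule additive_single_eqI)
  show "mon_rename Inl (mon_left (Poly_Mapping.single j c)) + mon_rename Inr (mon_right (Poly_Mapping.single j c)) =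
      Poly_Mapping.single j c" for j :: "'a + 'b" and c
    by (cases j) simp_all
qed (simp_all add: mon_rename_add mon_left_add mon_right_add ac_simps)

lemma mon_rename_comp: "mon_rename g (mon_rename h m) = mon_rename (g \<circ> h) m"
  by (rule additive_single_eqI) (simp_all add: mon_rename_add)

lemma prename_eq:
  "prename h p = (\<Sum>m\<in>Poly_Mapping.keys p. pconst (Poly_Mapping.lookup p m) * pmon (mon_rename h m))"
  by (simp add: prename_def single_eq_pconst_pmon)

lemma klinear_prename: "klinear (prename h)"
  unfolding prename_eq by (rule klinear_sum_keys)

lemma prename_pmon: "prename h (pmon m) = pmon (mon_rename h m)"
  by (simp add: prename_eq sum_keys_pmon)

lemma bilinear_eqI:
  assumes "\<And>q. klinear (\<lambda>p. F p q)" "\<And>p. klinear (F p)" "\<And>q. klinear (\<lambda>p. G p q)" "\<And>p. klinear (G p)"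
    and "\<And>m n. F (pmon m) (pmon n) = G (pmon m) (pmon n)"
  shows "F p q = G p q"
proof -
  have "F (pmon m) q = G (pmon m) q" for m
    by (rule klinear_eqI[of "F (pmon m)" "G (pmon m)"]) (rule assms)+
  then show ?thesis
    by (rule klinear_eqI[of "\<lambda>p. F p q" "\<lambda>p. G p q", OF assms(1,3)])
qed

lemma prename_mult: "prename h (p * q) = prename h p * prename h q"
  by (rule bilinear_eqI[of "\<lambda>p q. prename h (p * q)" "\<lambda>p q. prename h p * prename h q"])
    (auto intro!: klinear_compose[OF klinear_prename] klinear_mult_left klinear_mult_right klinear_prename
      simp: pmon_add[symmetric] prename_pmon mon_rename_add)

lemma prename_comp: "prename g (prename h p) = prename (g \<circ> h) p"
  by (rule klinear_eqI[of "\<lambda>p. prename g (prename h p)"])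
    (auto intro!: klinear_compose[OF klinear_prename] klinear_prename simp: prename_pmon mon_rename_comp comp_def)

abbreviation ptensor :: "('a, 'k::comm_ring_1) pa \<Rightarrow> ('b, 'k) pa \<Rightarrow> ('a + 'b, 'k) pa" where
  "ptensor p q \<equiv> prename Inl p * prename Inr q"

lemma pmon_eq_ptensor: "pmon m = ptensor (pmon (mon_left m)) (pmon (mon_right m))"
  by (simp add: prename_pmon pmon_add[symmetric] mon_left_right)

text \<open>\<open>sweedler F q\<close> is the sum of \<open>F q\<^sub>1 q\<^sub>2\<close> in Sweedler notation.\<close>
definition sweedler ::
  "(('a, 'k::comm_ring_1) pa \<Rightarrow> ('b, 'k) pa \<Rightarrow> ('c, 'k) pa) \<Rightarrow> ('a + 'b, 'k) pa \<Rightarrow> ('c, 'k) pa" where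
  "sweedler F q = (\<Sum>m\<in>Poly_Mapping.keys q.
     pconst (Poly_Mapping.lookup q m) * F (pmon (mon_left m)) (pmon (mon_right m)))"

definition kbilinear ::
  "(('a, 'k::comm_ring_1) pa \<Rightarrow> ('b, 'k) pa \<Rightarrow> ('c, 'k) pa) \<Rightarrow> bool" where
  "kbilinear F \<longleftrightarrow> (\<forall>p. klinear (F p)) \<and> (\<forall>q. klinear (\<lambda>p. F p q))"

lemma kbilinearI: "(\<And>p. klinear (F p)) \<Longrightarrow> (\<And>q. klinear (\<lambda>p. F p q)) \<Longrightarrow> kbilinear F"
  by (simp add: kbilinear_def)

lemma klinear_sweedler: "klinear (sweedler F)"
  unfolding sweedler_def by (rule klinear_sum_keys)

lemma sweedler_pmon: "sweedler F (pmon m) = F (pmon (mon_left m)) (pmon (mon_right m))"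
  by (simp add: sweedler_def sum_keys_pmon)

text \<open>This is the universal property of the tensor product: \<open>sweedler F\<close> is fixed
  on the monomial basis, and bilinearity of \<open>F\<close> determines its value on every pure
  tensor.\<close>

lemma sweedler_ptensor:
  assumes "kbilinear F"
  shows "sweedler F (ptensor p q) = F p q"
proof (rule bilinear_eqI[of "\<lambda>p q. sweedler F (ptensor p q)" F])
  show "klinear (\<lambda>p. sweedler F (ptensor p q))" for q
    by (intro klinear_compose[OF klinear_sweedler] klinear_mult_right klinear_prename)
  show "klinear (\<lambda>q. sweedler F (ptensor p q))" for p
    by (intro klinear_compose[OF klinear_sweedler] klinear_mult_left klinear_prename)
qed (use assms in \<open>auto simp: kbilinear_def prename_pmon pmon_add[symmetric] sweedler_pmon mon_left_add mon_right_add\<close>)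

lemma tensor_eqI:
  assumes "klinear f" "klinear g" "\<And>p q. f (ptensor p q) = g (ptensor p q)"
  shows "f r = g r"
  by (rule klinear_eqI[OF assms(1,2)]) (subst (1 2) pmon_eq_ptensor, rule assms(3))

lemma sweedler_apply: "klinear T \<Longrightarrow> T (sweedler F q) = sweedler (\<lambda>a b. T (F a b)) q"
  by (simp add: sweedler_def klinear_sum klinear_scale)

lemma sweedler_scale: "sweedler (\<lambda>a b. c * F a b) q = c * sweedler F q"
  using sweedler_apply[OF klinear_mult_left[OF klinear_id(1)], of c F q] by simp

lemma sweedler_add: "sweedler (\<lambda>a b. F a b + G a b) q = sweedler F q + sweedler G q"
  by (simp add: sweedler_def distrib_left sum.distrib)

lemma klinear_sweedler_fun:
  "(\<And>a b. klinear (\<lambda>p. F p a b)) \<Longrightarrow> klinear (\<lambda>p. sweedler (F p) q)"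
  unfolding sweedler_def by (intro klinear_sum_fun klinear_mult_left)

lemma sweedler_mult:
  "sweedler F (q * r) = sweedler (\<lambda>a b. sweedler (\<lambda>c d. F (a * c) (b * d)) r) q"
  by (rule bilinear_eqI[of "\<lambda>q r. sweedler F (q * r)"])
    (auto intro!: klinear_compose[OF klinear_sweedler] klinear_mult_left klinear_mult_right
        klinear_sweedler klinear_sweedler_fun
      simp: pmon_add[symmetric] sweedler_pmon mon_left_add mon_right_add)

lemma counit_left_eq: "counit_left e q = sweedler (\<lambda>a b. pconst (e a) * b) q"
  and counit_right_eq: "counit_right e q = sweedler (\<lambda>a b. pconst (e b) * a) q"
  and mult_tensor_eq: "mult_tensor f g q = sweedler (\<lambda>a b. f a * g b) q"
  and tensor_map_eq: "tensor_map f' g' q = sweedler (\<lambda>a b. ptensor (f' a) (g' b)) q"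
  by (simp_all add: counit_left_def counit_right_def mult_tensor_def tensor_map_def sweedler_def
      psmult_eq pconst_mult mult.assoc)

lemma tensor_bracket_eq:
  "tensor_bracket br q r =
    sweedler (\<lambda>a b. sweedler (\<lambda>c d. ptensor (br a c) (b * d) + ptensor (a * c) (br b d)) r) q"
  by (simp add: tensor_bracket_def sweedler_def psmult_eq pconst_mult mult.assoc sum_distrib_left)

lemma kbilinear_mult: "kbilinear (*)"
  by (intro kbilinearI klinear_intros)

lemma kbilinear_scale:
  fixes \<phi> :: "('b, 'k::comm_ring_1) pa \<Rightarrow> 'k"
  assumes "klinear (\<lambda>p. pconst (\<phi> p) :: ('a, 'k) pa)"
  shows "kbilinear (\<lambda>(a :: ('a, 'k) pa) b. pconst (\<phi> b) * a)"
  by (intro kbilinearI klinear_mult_left klinear_mult_right klinear_id assms)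

section \<open>Invariant derivations and the modular derivation of a Poisson coproduct\<close>

text \<open>\<open>W F f\<close> stands for the sum of \<open>F f\<^sub>1 f\<^sub>2\<close> over a coproduct of \<open>f\<close>; the
  assumptions are stable under passing to the opposite coproduct.\<close>
locale poisson_coproduct =
  fixes br :: "('v::finite, 'k::field) pa \<Rightarrow> ('v, 'k) pa \<Rightarrow> ('v, 'k) pa"
    and e :: "('v, 'k) pa \<Rightarrow> 'k"
    and S :: "('v, 'k) pa \<Rightarrow> ('v, 'k) pa"
    and W :: "(('v, 'k) pa \<Rightarrow> ('v, 'k) pa \<Rightarrow> ('v, 'k) pa) \<Rightarrow> ('v, 'k) pa \<Rightarrow> ('v, 'k) pa"
  assumes br: "poisson_bracket br"
    and e_klinear: "klinear (\<lambda>p. pconst (e p) :: ('v, 'k) pa)"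
    and e_mult: "e (p * q) = e p * e q"
    and e_1: "e 1 = 1"
    and W_klinear: "klinear (W F)"
    and W_apply: "klinear T \<Longrightarrow> T (W F f) = W (\<lambda>a b. T (F a b)) f"
    and W_add: "W (\<lambda>a b. F a b + G a b) f = W F f + W G f"
    and W_mult: "W F (f * g) = W (\<lambda>a b. W (\<lambda>c d. F (a * c) (b * d)) g) f"
    and W_br: "kbilinear F \<Longrightarrow>
      W F (br f g) = W (\<lambda>a b. W (\<lambda>c d. F (br a c) (b * d) + F (a * c) (br b d)) g) f"
    and W_counit_left: "W (\<lambda>a b. pconst (e a) * b) f = f"
    and W_counit_right: "W (\<lambda>a b. pconst (e b) * a) f = f"
    and W_antipode: "klinear (\<lambda>p. pconst (\<phi> p) :: ('v, 'k) pa) \<Longrightarrow>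
      W (\<lambda>a b. S a * W (\<lambda>c d. pconst (\<phi> d) * c) b) f = pconst (\<phi> f)"
begin

text \<open>For \<open>\<phi>\<close> equal to \<open>tangent j\<close> this is the invariant
  derivation with value \<open>tangent j\<close> at the identity; the opposite coproduct exchanges
  left and right invariance.\<close>

definition translate :: "(('v, 'k) pa \<Rightarrow> 'k) \<Rightarrow> ('v, 'k) pa \<Rightarrow> ('v, 'k) pa" where
  "translate \<phi> f = W (\<lambda>a b. pconst (\<phi> b) * a) f"

definition tangent :: "'v \<Rightarrow> ('v, 'k) pa \<Rightarrow> 'k" where
  "tangent j f = e (pderiv_var j f)"

lemma e_0: "e 0 = 0"
  using klinear_0[OF e_klinear] by (metis inj_pconst pconst_0)

lemma e_add: "e (p + q) = e p + e q"
  using klinear_add[OF e_klinear, of p q] by (simp only: pconst_add[symmetric] inj_pconst)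

lemma e_sum: "e (\<Sum>i\<in>I. f i) = (\<Sum>i\<in>I. e (f i))"
  by (induction I rule: infinite_finite_induct) (simp_all add: e_0 e_add)

lemma e_pconst: "e (pconst c) = c"
  using klinear_scale[OF e_klinear, of c 1] by (simp add: e_1 inj_pconst)

lemma klinear_e_compose: "klinear T \<Longrightarrow> klinear (\<lambda>p. pconst (e (T p)) :: ('v, 'k) pa)"
  by (rule klinear_compose[OF e_klinear])

lemma klinear_tangent: "klinear (\<lambda>p. pconst (tangent j p) :: ('v, 'k) pa)"
  unfolding tangent_def by (rule klinear_e_compose[OF klinear_pderiv_var])

lemma klinear_translate: "klinear (translate \<phi>)"
  unfolding translate_def by (rule W_klinear)

lemma translate_e: "translate e f = f"
  by (simp add: translate_def W_counit_right)

lemma W_scale: "W (\<lambda>a b. c * F a b) f = c * W F f"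
  using W_apply[OF klinear_mult_left[OF klinear_id(1)], of c F f] by simp

lemma translate_0: "translate (\<lambda>_. 0) f = 0"
  using W_scale[of 0 "\<lambda>a b. 0" f] by (simp add: translate_def)

lemma W_sum: "finite I \<Longrightarrow> W (\<lambda>a b. \<Sum>i\<in>I. F i a b) f = (\<Sum>i\<in>I. W (F i) f)"
proof (induction I rule: finite_induct)
  case empty
  show ?case using W_scale[of 0 "\<lambda>a b. 0"] by simp
qed (simp add: W_add)

lemma translate_bilinear:
  assumes "kbilinear H"
  shows "W (\<lambda>a b. W (\<lambda>c d. pconst (\<phi> b) * (pconst (\<psi> d) * H a c)) g) f = H (translate \<phi> f) (translate \<psi> g)"
proof -
  have H: "klinear (H a)" "klinear (\<lambda>a. H a c)" for a c
    using assms by (auto simp: kbilinear_def)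
  have "H (translate \<phi> f) (translate \<psi> g) = W (\<lambda>a b. H (pconst (\<phi> b) * a) (translate \<psi> g)) f"
    unfolding translate_def[of \<phi>] by (rule W_apply[OF H(2)])
  also have "\<dots> = W (\<lambda>a b. W (\<lambda>c d. pconst (\<phi> b) * (pconst (\<psi> d) * H a c)) g) f"
    unfolding klinear_scale[OF H(2)]
    by (simp only: translate_def W_apply[OF H(1)] klinear_scale[OF H(1)] W_scale)
  finally show ?thesis by simp
qed

lemma counit_bilinear:
  assumes "kbilinear H"
  shows "W (\<lambda>a b. W (\<lambda>c d. pconst (e a) * (pconst (e c) * H b d)) g) f = H f g"
proof -
  have H: "klinear (H a)" "klinear (\<lambda>a. H a c)" for a c
    using assms by (auto simp: kbilinear_def)
  have "H f g = H (W (\<lambda>a b. pconst (e a) * b) f) (W (\<lambda>a b. pconst (e a) * b) g)"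
    by (simp add: W_counit_left)
  also have "\<dots> = W (\<lambda>a b. H (pconst (e a) * b) (W (\<lambda>a b. pconst (e a) * b) g)) f"
    by (rule W_apply[OF H(2)])
  also have "\<dots> = W (\<lambda>a b. W (\<lambda>c d. pconst (e a) * (pconst (e c) * H b d)) g) f"
    unfolding klinear_scale[OF H(2)]
    by (simp only: W_apply[OF H(1)] klinear_scale[OF H(1)] W_scale)
  finally show ?thesis by simp
qed

lemma kbilinear_br: "kbilinear br"
  by (intro kbilinearI bracket_klinear_left bracket_klinear_right br)

text \<open>Applying the counit to the second leg of the bracket rule returns \<open>br f g\<close>
  plus the remainder \<open>?R\<close>, so \<open>?R\<close> is 0. Applying the counit to
  \<open>?R\<close> also contracts the first leg and leaves \<open>e (br f g)\<close>.\<close>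

lemma e_br: "e (br f g) = 0"
proof -
  let ?R = "W (\<lambda>a b. W (\<lambda>c d. pconst (e (br b d)) * (a * c)) g) f"
  have "br f g = translate e (br f g)"
    by (simp add: translate_e)
  also have "\<dots> = W (\<lambda>a b. W (\<lambda>c d. pconst (e b) * (pconst (e d) * br a c)) g) f + ?R"
    unfolding translate_def W_br[OF kbilinear_scale[OF e_klinear]]
    by (simp add: W_add e_mult pconst_mult mult.assoc)
  also have "\<dots> = br f g + ?R"
    by (simp add: translate_bilinear[OF kbilinear_br] translate_e)
  finally have "?R = 0" by simp
  then have "0 = pconst (e ?R)" by (simp add: e_0)
  also have "\<dots> = W (\<lambda>a b. W (\<lambda>c d. pconst (e a) * (pconst (e c) * pconst (e (br b d)))) g) f"
    by (simp add: W_apply[OF e_klinear] e_mult e_pconst pconst_mult mult_ac)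
  also have "\<dots> = pconst (e (br f g))"
    by (rule counit_bilinear)
      (intro kbilinearI klinear_e_compose bracket_klinear_left bracket_klinear_right br)
  finally show ?thesis
    by (metis inj_pconst pconst_0)
qed

lemma derivation_translate: "derivation (translate (tangent j))"
proof -
  have "translate (tangent j) (f * g) = f * translate (tangent j) g + translate (tangent j) f * g" for f g
  proof -
    have "translate (tangent j) (f * g) =
        W (\<lambda>a b. W (\<lambda>c d. pconst (e b) * (pconst (tangent j d) * (a * c))) g) f +
        W (\<lambda>a b. W (\<lambda>c d. pconst (tangent j b) * (pconst (e d) * (a * c))) g) f"
      unfolding translate_def W_mult
      by (simp add: tangent_def derivation_mult[OF derivation_pderiv_var] e_add e_mult
          pconst_add pconst_mult distrib_right W_add mult.assoc)
    then show ?thesis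
      by (simp add: translate_bilinear[OF kbilinear_mult] translate_e)
  qed
  then show ?thesis
    by (simp add: derivation_def klinear_translate)
qed

text \<open>When \<open>br b d\<close> is written through \<open>br b (pvar p)\<close>, the second
  derivatives of \<open>d\<close> carry the factor \<open>br b (pvar p)\<close>, which the counit
  kills by \<open>e_br\<close>.\<close>

lemma tangent_br: "tangent j (br b d) = (\<Sum>p\<in>UNIV. tangent j (br b (pvar p)) * tangent p d)"
proof -
  have "tangent j (br b d) = e (pderiv_var j (\<Sum>p\<in>UNIV. br b (pvar p) * pderiv_var p d))"
    unfolding tangent_def by (subst derivation_expansion[OF derivation_bracket_right[OF br]]) (rule refl)
  then show ?thesis
    by (simp add: klinear_sum[OF klinear_pderiv_var] derivation_mult[OF derivation_pderiv_var]
        e_sum e_add e_mult e_br tangent_def)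
qed

text \<open>\<open>tangent j\<close> is applied to the second leg of the bracket rule: on
  \<open>b * d\<close> it splits by the Leibniz rule, on \<open>br b d\<close> by
  \<open>tangent_br\<close>. The last sum supplies the \<open>Q\<close> of
  \<open>modular_derivation_frame\<close>.\<close>

lemma translate_tangent_br:
  "translate (tangent j) (br f g) = br (translate (tangent j) f) g + br f (translate (tangent j) g) +
    (\<Sum>p\<in>UNIV. translate (\<lambda>b. tangent j (br b (pvar p))) f * translate (tangent p) g)"
proof -
  have "translate (tangent j) (br f g) =
      W (\<lambda>a b. W (\<lambda>c d. pconst (e b) * (pconst (tangent j d) * br a c)) g) f +
      W (\<lambda>a b. W (\<lambda>c d. pconst (tangent j b) * (pconst (e d) * br a c)) g) f +
      W (\<lambda>a b. W (\<lambda>c d. pconst (tangent j (br b d)) * (a * c)) g) f"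
    unfolding translate_def W_br[OF kbilinear_scale[OF klinear_tangent]]
    by (simp add: tangent_def derivation_mult[OF derivation_pderiv_var] e_add e_mult
        pconst_add pconst_mult distrib_right W_add mult.assoc)
  also have "W (\<lambda>a b. W (\<lambda>c d. pconst (tangent j (br b d)) * (a * c)) g) f =
      (\<Sum>p\<in>UNIV. W (\<lambda>a b. W (\<lambda>c d. pconst (tangent j (br b (pvar p))) * (pconst (tangent p d) * (a * c))) g) f)"
  proof -
    define t where "t b p = tangent j (br b (pvar p))" for b p
    have "pconst (tangent j (br b d)) * x =
        (\<Sum>p\<in>UNIV. pconst (t b p) * (pconst (tangent p d) * x))" for b d and x :: "('v, 'k) pa"
      unfolding tangent_br[of j b d] t_def
      by (simp add: pconst_sum sum_distrib_right pconst_mult mult.assoc)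
    then show ?thesis by (simp add: W_sum flip: t_def)
  qed
  finally show ?thesis
    by (simp add: translate_bilinear[OF kbilinear_br] translate_bilinear[OF kbilinear_mult] translate_e)
qed

definition frame_inverse :: "'v \<Rightarrow> 'v \<Rightarrow> ('v, 'k) pa" where
  "frame_inverse i k = W (\<lambda>a b. S a * pderiv_var k b) (pvar i)"

text \<open>By the chain rule the sum over \<open>k\<close> turns into
  \<open>S a * translate (tangent j) b\<close>. The antipode then cancels the first two of three
  legs, leaving the constant \<open>tangent j (pvar i)\<close>.\<close>

lemma frame_inverse:
  "(\<Sum>k\<in>UNIV. frame_inverse i k * translate (tangent j) (pvar k)) = (if i = j then 1 else 0)"
proof -
  have "(\<Sum>k\<in>UNIV. frame_inverse i k * translate (tangent j) (pvar k)) =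
      W (\<lambda>a b. \<Sum>k\<in>UNIV. translate (tangent j) (pvar k) * (S a * pderiv_var k b)) (pvar i)"
    unfolding frame_inverse_def W_sum[OF finite] W_scale by (simp only: mult.commute)
  also have "\<dots> = W (\<lambda>a b. S a * translate (tangent j) b) (pvar i)"
    by (subst derivation_expansion[OF derivation_translate]) (simp add: sum_distrib_left mult_ac)
  also have "\<dots> = pconst (tangent j (pvar i))"
    unfolding translate_def by (rule W_antipode[OF klinear_tangent])
  finally show ?thesis
    by (simp add: tangent_def pderiv_var_pvar e_1 e_0)
qed

text \<open>The trace of \<open>Q\<close> is the translated term, because
  \<open>e (modular_derivation br b)\<close> is the sum of \<open>tangent j (br b (pvar j))\<close>
  over \<open>j\<close>.\<close>

theorem modular_derivation_translate:
  "modular_derivation br f = translate (\<lambda>g. e (modular_derivation br g)) f +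
    (\<Sum>i\<in>UNIV. \<Sum>j\<in>UNIV. frame_inverse j i * br (translate (tangent j) f) (pvar i))"
proof -
  have "translate (\<lambda>g. e (modular_derivation br g)) f =
      (\<Sum>j\<in>UNIV. translate (\<lambda>b. tangent j (br b (pvar j))) f)"
    unfolding translate_def
    by (subst W_sum[symmetric])
      (simp_all add: modular_derivation_def e_sum tangent_def pconst_sum sum_distrib_right)
  then show ?thesis
    using modular_derivation_frame[OF br derivation_translate frame_inverse translate_tangent_br, of f]
    by simp
qed

end

section \<open>Coassociativity and the two coproducts of a Poisson Hopf algebra\<close>

text \<open>Coassociativity is an identity of polynomials in three copies of the variables. The
  linear map \<open>\<tau>\<close> induced by the trilinear \<open>F\<close> on the right-nested
  tensor product turns it into an equality of iterated sums.\<close>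

lemma sweedler_coassoc:
  fixes F :: "('a, 'k::comm_ring_1) pa \<Rightarrow> ('a, 'k) pa \<Rightarrow> ('a, 'k) pa \<Rightarrow> ('c, 'k) pa"
  assumes coassoc: "prename assoc_var (tensor_map D id (D f)) = tensor_map id D (D f)"
    and lin: "\<And>b c. klinear (\<lambda>a. F a b c)" "\<And>a c. klinear (\<lambda>b. F a b c)" "\<And>a b. klinear (F a b)"
  shows "sweedler (\<lambda>a b. sweedler (F a) (D b)) (D f) =
    sweedler (\<lambda>a b. sweedler (\<lambda>c d. F c d b) (D a)) (D f)"
proof -
  define \<tau> where "\<tau> = sweedler (\<lambda>a r. sweedler (F a) r)"
  have bil: "kbilinear (\<lambda>a r. sweedler (F a) r)"
    by (intro kbilinearI klinear_sweedler klinear_sweedler_fun lin)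
  have \<tau>: "klinear \<tau>" "\<And>a r. \<tau> (ptensor a r) = sweedler (F a) r"
    by (simp_all add: \<tau>_def klinear_sweedler sweedler_ptensor[OF bil])
  have assoc: "\<tau> (prename assoc_var (ptensor q b)) = sweedler (\<lambda>c d. F c d b) q" for q b
  proof (rule tensor_eqI[of "\<lambda>q. \<tau> (prename assoc_var (ptensor q b))"])
    show "klinear (\<lambda>q. \<tau> (prename assoc_var (ptensor q b)))"
      by (intro klinear_compose[OF \<tau>(1)] klinear_compose[OF klinear_prename] klinear_mult_right klinear_prename)
    fix c d :: "('a, 'k) pa"
    have "prename assoc_var (ptensor (ptensor c d) b) = ptensor c (ptensor d b)"
      by (simp add: prename_mult prename_comp assoc_var_def comp_def mult.assoc)
    then have "\<tau> (prename assoc_var (ptensor (ptensor c d) b)) = sweedler (F c) (ptensor d b)"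
      by (simp only: \<tau>)
    also have "\<dots> = F c d b"
      by (intro sweedler_ptensor kbilinearI lin)
    also have "\<dots> = sweedler (\<lambda>c d. F c d b) (ptensor c d)"
      by (rule sweedler_ptensor[symmetric]) (intro kbilinearI lin)
    finally show "\<tau> (prename assoc_var (ptensor (ptensor c d) b)) = sweedler (\<lambda>c d. F c d b) (ptensor c d)" .
  qed (rule klinear_sweedler)
  have "sweedler (\<lambda>a b. sweedler (F a) (D b)) (D f) = \<tau> (tensor_map id D (D f))"
    by (simp add: tensor_map_eq sweedler_apply[OF \<tau>(1)] \<tau>(2))
  also have "\<dots> = \<tau> (prename assoc_var (tensor_map D id (D f)))"
    by (simp only: coassoc)
  also have "\<dots> = sweedler (\<lambda>a b. sweedler (\<lambda>c d. F c d b) (D a)) (D f)"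
    by (simp add: tensor_map_eq sweedler_apply[OF klinear_prename] sweedler_apply[OF \<tau>(1)] assoc)
  finally show ?thesis .
qed


lemma hopf_coproduct:
  fixes br :: "('v::finite, 'k::field) pa \<Rightarrow> ('v, 'k) pa \<Rightarrow> ('v, 'k) pa"
  assumes hopf: "poisson_hopf br D e S"
  shows "poisson_coproduct br e S (\<lambda>F f. sweedler F (D f))"
    and "poisson_coproduct br e S (\<lambda>F f. sweedler (\<lambda>a b. F b a) (D f))"
proof -
  note H = hopf[unfolded poisson_hopf_def counit_left_eq counit_right_eq mult_tensor_eq tensor_bracket_eq psmult_eq id_apply]
  have br: "poisson_bracket br" and D: "klinear D" "\<forall>p q. D (p * q) = D p * D q"
    and e: "\<forall>p q. e (p + q) = e p + e q" "\<forall>c p. e (pconst c * p) = c * e p"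
      "\<forall>p q. e (p * q) = e p * e q" "e 1 = 1"
    and counit: "\<forall>p. sweedler (\<lambda>a b. pconst (e a) * b) (D p) = p" "\<forall>p. sweedler (\<lambda>a b. pconst (e b) * a) (D p) = p"
    and S: "klinear S" "\<forall>p. sweedler (\<lambda>a b. S a * b) (D p) = pconst (e p)"
      "\<forall>p. sweedler (\<lambda>a b. a * S b) (D p) = pconst (e p)"
    and D_br: "\<forall>p q. D (br p q) = sweedler (\<lambda>a b. sweedler (\<lambda>c d.
        ptensor (br a c) (b * d) + ptensor (a * c) (br b d)) (D q)) (D p)"
    by (insert H, (elim conjE, assumption)+)
  have coassoc: "\<forall>p. prename assoc_var (tensor_map D id (D p)) = tensor_map id D (D p)"
    using hopf unfolding poisson_hopf_def by (elim conjE)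
  note D = D[rule_format] and e = e[rule_format] and coassoc = coassoc[rule_format]
    and counit = counit[rule_format] and S = S[rule_format] and D_br = D_br[rule_format]
  have e_klinear: "klinear (\<lambda>p. pconst (e p) :: ('v, 'k) pa)"
    by (rule klinearI) (simp_all add: e(1,2) pconst_add pconst_mult)
  have D_klinear: "klinear (\<lambda>f. sweedler F (D f))" for F :: "('v, 'k) pa \<Rightarrow> ('v, 'k) pa \<Rightarrow> ('v, 'k) pa"
    by (rule klinear_compose[OF klinear_sweedler D(1)])
  have swe_br: "sweedler F (D (br f g)) =
      sweedler (\<lambda>a b. sweedler (\<lambda>c d. F (br a c) (b * d) + F (a * c) (br b d)) (D g)) (D f)"
    if "kbilinear F" for F :: "('v, 'k) pa \<Rightarrow> ('v, 'k) pa \<Rightarrow> ('v, 'k) pa" and f g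
    by (simp add: D_br sweedler_apply[OF klinear_sweedler] klinear_add[OF klinear_sweedler] sweedler_ptensor[OF that])
  have flip: "kbilinear (\<lambda>a b. F b a)" if "kbilinear F" for F :: "('v, 'k) pa \<Rightarrow> ('v, 'k) pa \<Rightarrow> ('v, 'k) pa"
    using that by (simp add: kbilinear_def)
  \<comment> \<open>In three legs the left side reads
    \<open>S(f\<^sub>1) f\<^sub>2 \<phi>(f\<^sub>3)\<close>; the antipode axiom collapses the first
    two legs to a counit, which then disappears.\<close>
  have antipode_left: "sweedler (\<lambda>a b. S a * sweedler (\<lambda>c d. pconst (\<phi> d) * c) (D b)) (D f) = pconst (\<phi> f)"
    if \<phi>: "klinear (\<lambda>p. pconst (\<phi> p) :: ('v, 'k) pa)" for \<phi> f
  proof -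
    have "sweedler (\<lambda>a b. S a * sweedler (\<lambda>c d. pconst (\<phi> d) * c) (D b)) (D f) =
        sweedler (\<lambda>a b. sweedler (\<lambda>c d. S a * (pconst (\<phi> d) * c)) (D b)) (D f)"
      by (simp only: sweedler_scale)
    also have "\<dots> = sweedler (\<lambda>a b. sweedler (\<lambda>c d. S c * (pconst (\<phi> b) * d)) (D a)) (D f)"
      by (rule sweedler_coassoc[OF coassoc]) (intro klinear_mult_left klinear_mult_right klinear_id S(1) \<phi>)+
    also have "\<dots> = sweedler (\<lambda>a b. pconst (\<phi> b) * pconst (e a)) (D f)"
      by (simp only: mult.left_commute[of "S _"] sweedler_scale S(2))
    also have "\<dots> = pconst (\<phi> (sweedler (\<lambda>a b. pconst (e a) * b) (D f)))"
      by (simp only: sweedler_apply[OF \<phi>] klinear_scale[OF \<phi>]) (simp only: mult.commute)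
    finally show ?thesis by (simp only: counit)
  qed
  \<comment> \<open>By commutativity the opposite coproduct keeps the antipode: the three legs read
    \<open>\<phi>(f\<^sub>1) f\<^sub>2 S(f\<^sub>3)\<close>, and the other antipode axiom
    applies.\<close>
  have antipode_right: "sweedler (\<lambda>a b. S b * sweedler (\<lambda>c d. pconst (\<phi> c) * d) (D a)) (D f) = pconst (\<phi> f)"
    if \<phi>: "klinear (\<lambda>p. pconst (\<phi> p) :: ('v, 'k) pa)" for \<phi> f
  proof -
    have "sweedler (\<lambda>a b. S b * sweedler (\<lambda>c d. pconst (\<phi> c) * d) (D a)) (D f) =
        sweedler (\<lambda>a b. sweedler (\<lambda>c d. pconst (\<phi> c) * (d * S b)) (D a)) (D f)"
      by (simp only: sweedler_scale[symmetric] mult_ac)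
    also have "\<dots> = sweedler (\<lambda>a b. sweedler (\<lambda>c d. pconst (\<phi> a) * (c * S d)) (D b)) (D f)"
      by (rule sweedler_coassoc[OF coassoc, symmetric])
        (intro klinear_mult_left klinear_mult_right klinear_id S(1) \<phi>)+
    also have "\<dots> = sweedler (\<lambda>a b. pconst (\<phi> a) * pconst (e b)) (D f)"
      by (simp only: sweedler_scale S(3))
    also have "\<dots> = pconst (\<phi> (sweedler (\<lambda>a b. pconst (e b) * a) (D f)))"
      by (simp only: sweedler_apply[OF \<phi>] klinear_scale[OF \<phi>]) (simp only: mult.commute)
    finally show ?thesis by (simp only: counit)
  qed
  show "poisson_coproduct br e S (\<lambda>F f. sweedler F (D f))"
    by unfold_locales
      (fact br e_klinear e(3) e(4) D_klinear sweedler_apply sweedler_add swe_br counit antipode_left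
        | simp add: D(2) sweedler_mult)+
  show "poisson_coproduct br e S (\<lambda>F f. sweedler (\<lambda>a b. F b a) (D f))"
  proof unfold_locales
    show "sweedler (\<lambda>a b. F b a) (D (br f g)) =
        sweedler (\<lambda>b a. sweedler (\<lambda>d c. F (br a c) (b * d) + F (a * c) (br b d)) (D g)) (D f)"
      if "kbilinear F" for F :: "('v, 'k) pa \<Rightarrow> ('v, 'k) pa \<Rightarrow> ('v, 'k) pa" and f g
      by (simp add: swe_br[OF flip[OF that]] add.commute)
  qed (fact br e_klinear e(3) e(4) D_klinear sweedler_apply sweedler_add counit antipode_right
        | simp add: D(2) sweedler_mult)+
qed

text \<open>\<open>L\<close> acts on the last leg and \<open>R\<close> on the first, so by
  coassociativity both composites are
  \<open>\<psi>(f\<^sub>1) f\<^sub>2 \<phi>(f\<^sub>3)\<close>.\<close>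

lemma translate_commute:
  fixes D :: "('v, 'k::comm_ring_1) pa \<Rightarrow> ('v + 'v, 'k) pa"
  assumes D: "klinear D" and coassoc: "\<And>p. prename assoc_var (tensor_map D id (D p)) = tensor_map id D (D p)"
    and \<phi>: "klinear (\<lambda>p. pconst (\<phi> p) :: ('v, 'k) pa)" and \<psi>: "klinear (\<lambda>p. pconst (\<psi> p) :: ('v, 'k) pa)"
  defines "L \<equiv> \<lambda>f. sweedler (\<lambda>a b. pconst (\<phi> b) * a) (D f)"
    and "R \<equiv> \<lambda>f. sweedler (\<lambda>a b. pconst (\<psi> a) * b) (D f)"
  shows "L (R f) = R (L f)"
proof -
  have lin: "klinear L" "klinear R"
    unfolding L_def R_def by (rule klinear_compose[OF klinear_sweedler D])+
  have "L (R f) = sweedler (\<lambda>a b. pconst (\<psi> a) * L b) (D f)"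
    unfolding R_def by (simp only: sweedler_apply[OF lin(1)] klinear_scale[OF lin(1)])
  also have "\<dots> = sweedler (\<lambda>a b. sweedler (\<lambda>c d. pconst (\<psi> a) * (pconst (\<phi> d) * c)) (D b)) (D f)"
    by (simp only: L_def sweedler_scale)
  also have "\<dots> = sweedler (\<lambda>a b. sweedler (\<lambda>c d. pconst (\<psi> c) * (pconst (\<phi> b) * d)) (D a)) (D f)"
    by (rule sweedler_coassoc[OF coassoc]) (intro klinear_mult_left klinear_mult_right klinear_id \<phi> \<psi>)+
  also have "\<dots> = sweedler (\<lambda>a b. pconst (\<phi> b) * R a) (D f)"
    by (simp only: R_def sweedler_scale mult.left_commute[of "pconst (\<psi> _)"])
  also have "\<dots> = R (L f)"
    unfolding L_def by (simp only: sweedler_apply[OF lin(2)] klinear_scale[OF lin(2)])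
  finally show ?thesis .
qed

section \<open>Combining the two invariant frames with the grading\<close>

theorem theorem0p1:
  fixes br :: "('v::finite, 'k::field_char_0) pa \<Rightarrow> ('v, 'k) pa \<Rightarrow> ('v, 'k) pa"
    and D :: "('v, 'k) pa \<Rightarrow> ('v + 'v, 'k) pa"
    and e :: "('v, 'k) pa \<Rightarrow> 'k"
    and S :: "('v, 'k) pa \<Rightarrow> ('v, 'k) pa"
    and G :: "nat \<Rightarrow> ('v, 'k) pa set"
    and d :: nat
  assumes "alg_closed TYPE('k)"
    and "poisson_hopf br D e S"
    and "connected_graded G"
    and "\<forall>i j. \<forall>p\<in>G i. \<forall>q\<in>G j. br p q \<in> G (i + j + d)"
  shows "\<forall>f. modular_derivation br f = 0"
proof -
  let ?\<delta> = "modular_derivation br"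
  interpret L: poisson_coproduct br e S "\<lambda>F f. sweedler F (D f)"
    by (rule hopf_coproduct(1)[OF assms(2)])
  interpret R: poisson_coproduct br e S "\<lambda>F f. sweedler (\<lambda>a b. F b a) (D f)"
    by (rule hopf_coproduct(2)[OF assms(2)])
  obtain \<epsilon> :: "('v, 'k) pa \<Rightarrow> ('v, 'k) pa" where \<epsilon>: "klinear \<epsilon>" "\<And>p q. \<epsilon> (p * q) = \<epsilon> p * \<epsilon> q" "\<epsilon> 1 = 1"
    "\<And>p q. \<epsilon> (br p q) = 0" "\<And>p. \<epsilon> (?\<delta> p) = 0"
    by (rule graded_augmentation[OF L.br assms(3) assms(4)[rule_format]]) (assumption | rule that)+
  have \<epsilon>_pconst: "\<epsilon> (pconst c) = pconst c" for c
    using klinear_scale[OF \<epsilon>(1), of c 1] by (simp add: \<epsilon>(3))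
  \<comment> \<open>A derivation followed by the counit is a tangent vector at the identity, hence a
    combination of the \<open>L.tangent j\<close>; its coefficients are the unknowns to be shown
    zero.\<close>
  have X: "e (?\<delta> f) = (\<Sum>j\<in>UNIV. e (?\<delta> (pvar j)) * L.tangent j f)" for f
    by (subst derivation_expansion[OF derivation_modular_derivation[OF L.br]])
      (simp add: L.e_sum L.e_mult L.tangent_def)
  have translate_X: "L.translate (\<lambda>g. e (?\<delta> g)) f =
      (\<Sum>j\<in>UNIV. pconst (e (?\<delta> (pvar j))) * L.translate (L.tangent j) f)" for f
  proof -
    define x where "x j = e (?\<delta> (pvar j))" for j
    have "pconst (e (?\<delta> b)) * a = (\<Sum>j\<in>UNIV. pconst (x j) * (pconst (L.tangent j b) * a))"
      for a b :: "('v, 'k) pa"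
      unfolding X[of b] x_def by (simp add: pconst_sum pconst_mult sum_distrib_right mult.assoc)
    then show ?thesis
      by (simp add: L.translate_def L.W_sum L.W_scale flip: x_def)
  qed
  \<comment> \<open>Applying \<open>\<epsilon>\<close> to the formula for \<open>?\<delta> f\<close>
    removes the left side and, by multiplicativity, every bracket term.\<close>
  have zero: "\<epsilon> (L.translate (\<lambda>g. e (?\<delta> g)) f) = 0" for f
    using \<epsilon>(5)[of f] unfolding L.modular_derivation_translate[of f]
    by (simp add: klinear_add[OF \<epsilon>(1)] klinear_sum[OF \<epsilon>(1)] \<epsilon>(2,4))
  have "e (?\<delta> (pvar l)) = 0" for l
  proof -
    let ?x = "\<lambda>j. pconst (e (?\<delta> (pvar j))) :: ('v, 'k) pa"
    let ?A = "\<lambda>i j. \<epsilon> (L.translate (L.tangent j) (pvar i))"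
    \<comment> \<open>Being multiplicative, \<open>\<epsilon>\<close> preserves the relation between
      the frame and its inverse, so the homogeneous linear system for the \<open>?x j\<close> has
      only the zero solution.\<close>
    have inv: "(\<Sum>i\<in>UNIV. \<epsilon> (L.frame_inverse l i) * ?A i j) = (if l = j then 1 else 0)" for j
      using arg_cong[OF L.frame_inverse[of l j], of \<epsilon>]
      by (simp add: klinear_sum[OF \<epsilon>(1)] \<epsilon>(2,3) klinear_0[OF \<epsilon>(1)] if_distrib[of \<epsilon>])
    have "(\<Sum>j\<in>UNIV. ?x j * ?A i j) = 0" for i
      using zero[of "pvar i"]
      by (simp add: translate_X klinear_sum[OF \<epsilon>(1)] klinear_scale[OF \<epsilon>(1)])
    then have "0 = (\<Sum>i\<in>UNIV. \<epsilon> (L.frame_inverse l i) * (\<Sum>j\<in>UNIV. ?x j * ?A i j))"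
      by simp
    also have "\<dots> = (\<Sum>i\<in>UNIV. \<Sum>j\<in>UNIV. ?x j * (\<epsilon> (L.frame_inverse l i) * ?A i j))"
      by (simp add: sum_distrib_left mult.left_commute)
    also have "\<dots> = (\<Sum>j\<in>UNIV. ?x j * (\<Sum>i\<in>UNIV. \<epsilon> (L.frame_inverse l i) * ?A i j))"
      by (subst sum.swap) (simp add: sum_distrib_left)
    also have "\<dots> = ?x l"
      by (simp add: inv if_distrib cong: if_cong)
    finally show ?thesis
      by (metis inj_pconst pconst_0)
  qed
  then have "e (?\<delta> f) = 0" for f
    unfolding X[of f] by simp
  then have X_0: "(\<lambda>g. e (?\<delta> g)) = (\<lambda>_. 0)" by (rule ext)
  \<comment> \<open>With the translated terms gone, \<open>?\<delta>\<close> is the contraction of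
    the bracket with either frame, both built from the same tangent vectors.\<close>
  have L: "?\<delta> f = (\<Sum>i\<in>UNIV. \<Sum>j\<in>UNIV. L.frame_inverse j i * br (L.translate (L.tangent j) f) (pvar i))"
    and R: "?\<delta> f = (\<Sum>i\<in>UNIV. \<Sum>j\<in>UNIV. R.frame_inverse j i * br (R.translate (L.tangent j) f) (pvar i))" for f
    by (fact L.modular_derivation_translate[of f, unfolded X_0 L.translate_0 add_0_left])
      (fact R.modular_derivation_translate[of f, unfolded X_0 R.translate_0 add_0_left])
  have commute: "L.translate (L.tangent i) (R.translate (L.tangent j) f) =
      R.translate (L.tangent j) (L.translate (L.tangent i) f)" for i j f
    unfolding L.translate_def R.translate_def
    by (rule translate_commute[OF _ _ L.klinear_tangent L.klinear_tangent])
      (use assms(2) in \<open>simp_all add: poisson_hopf_def\<close>)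
  \<comment> \<open>The two frames commute, so their contractions cancel, yet each equals
    \<open>?\<delta> f\<close>.\<close>
  have "?\<delta> f + ?\<delta> f = 0" for f
    using commuting_frames_cancel[OF L.br L.derivation_translate L.frame_inverse
        R.derivation_translate R.frame_inverse, of f]
    unfolding L[symmetric] R[symmetric] by (simp add: commute)
  then have "pconst 2 * ?\<delta> f = 0" for f
    by (simp add: pconst_def)
  then have "pconst (inverse 2) * (pconst 2 * ?\<delta> f) = 0" for f
    by simp
  then show ?thesis
    by (simp add: mult.assoc[symmetric] pconst_mult[symmetric])
qed

end
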